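(* Consider the Bohman–Frieze process on $n$ vertices and let $\mathrm{BF}(t)$ be the graph after $\lfloor nt/2\rfloor$ rounds. Let $t_c$ and $\bar s_2,\bar s_3,\bar s_4$ be as defined below. Then for any fixed $t\in[0,t_c)$ and $k=2,3,4$, $s_k(\mathrm{BF}(t))\to\bar s_k(t)$ in probability as $n\to\infty$.
   Context: Bohman–Frieze process: start with the empty graph on $n$ vertices; in each round, two edges $e_1=\{v_1,w_1\}$ and $e_2=\{v_2,w_2\}$ are chosen independently and uniformly at random; if both $v_1$ and $w_1$ are isolated vertices in the current graph, $e_1$ is added, otherwise $e_2$ is added. For a graph $G$ with component sizes $C_i$, $s_k(G)=\frac{1}{|G|}\sum_i C_i^k$. Let $\bar x$ solve $\bar x'=-\bar x^2-(1-\bar x^2)\bar x$, $\bar x(0)=1$ (defined and positive on $[0,\infty)$), and let $\bar s_2,\bar s_3,\bar s_4$ solve $\bar s_2'=\bar x^2+(1-\bar x^2)\bar s_2^2$, $\bar s_3'=3\bar x^2+3(1-\bar x^2)\bar s_2\bar s_3$, $\bar s_4'=7\bar x^2+(1-\bar x^2)(4\bar s_2\bar s_4+3\bar s_3^2)$ with $\bar s_2(0)=\bar s_3(0)=\bar s_4(0)=1$; $t_c\in(0,\infty)$ is the explosion time of $\bar s_2$ (so $\bar s_2(t)\to\infty$ as $t\uparrow t_c$), and these functions are defined on $[0,t_c)$. *)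

theory Defs
  imports "HOL-Probability.Probability"
begin

text \<open>Graphs on the vertex set {0..<n} are represented by their edge sets;
  an edge is a 2-element set of vertices.\<close>

definition all_edges :: "nat \<Rightarrow> nat set set" where
  "all_edges n = {e. \<exists>v w. v < n \<and> w < n \<and> v \<noteq> w \<and> e = {v, w}}"

definition isolated :: "nat set set \<Rightarrow> nat \<Rightarrow> bool" where
  "isolated G v \<longleftrightarrow> (\<forall>e\<in>G. v \<notin> e)"

definition bf_step :: "nat \<Rightarrow> nat set set \<Rightarrow> nat set set pmf" where
  "bf_step n G =
     (if n < 2 then return_pmf G
      else bind_pmf (pmf_of_set (all_edges n)) (\<lambda>e1.
           bind_pmf (pmf_of_set (all_edges n)) (\<lambda>e2.
             return_pmf (if (\<forall>v\<in>e1. isolated G v) then insert e1 G else insert e2 G))))"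

fun bf :: "nat \<Rightarrow> nat \<Rightarrow> nat set set pmf" where
  "bf n 0 = return_pmf {}"
| "bf n (Suc m) = bind_pmf (bf n m) (bf_step n)"

definition adj :: "nat set set \<Rightarrow> (nat \<times> nat) set" where
  "adj G = {(a, b). {a, b} \<in> G}"

definition component :: "nat set set \<Rightarrow> nat \<Rightarrow> nat set" where
  "component G v = {w. (v, w) \<in> (adj G)\<^sup>*}"

definition components :: "nat \<Rightarrow> nat set set \<Rightarrow> nat set set" where
  "components n G = component G ` {..<n}"

definition susc :: "nat \<Rightarrow> nat \<Rightarrow> nat set set \<Rightarrow> real" where
  "susc k n G = (1 / real n) * (\<Sum>C\<in>components n G. real (card C) ^ k)"

definition conv_in_prob :: "(nat \<Rightarrow> 'a pmf) \<Rightarrow> (nat \<Rightarrow> 'a \<Rightarrow> real) \<Rightarrow> real \<Rightarrow> bool" where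
  "conv_in_prob P X c \<longleftrightarrow>
     (\<forall>\<epsilon>>0. (\<lambda>n. measure_pmf.prob (P n) {a. \<bar>X n a - c\<bar> > \<epsilon>}) \<longlonglongrightarrow> 0)"

definition BF :: "real \<Rightarrow> nat \<Rightarrow> nat set set pmf" where
  "BF t n = bf n (nat \<lfloor>real n * t / 2\<rfloor>)"

end

theory Submission
  imports Defs
begin

text \<open>
  Let \<open>Y\<close> be the vector of the fraction of isolated vertices and \<open>s\<^sub>2, s\<^sub>3, s\<^sub>4\<close>, and let \<open>y\<close> be the
  solution of the differential equations. One round takes time \<open>2/n\<close>, and merging components of
  sizes \<open>a\<close> and \<open>b\<close> changes each \<open>n Y\<^sub>j\<close> by at most \<open>7 (a\<^sup>3 b + a b\<^sup>3)\<close>. As long as \<open>s\<^sub>4 \<le> B\<close>, all components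
  have size at most \<open>L = (n B)\<^bsup>1/4\<^esup>\<close>, so the drift of \<open>Y\<close> agrees with the differential equation up to
  \<open>O(L\<^sup>2/n\<^sup>2)\<close> and the second moment of a jump is \<open>O(L\<^sup>3/n\<^sup>2)\<close>; both are \<open>o(1/n)\<close>.
  Consequently \<open>V = |Y - y|\<^sup>2\<close> satisfies a discrete Gronwall inequality in expectation wherever \<open>V < 1\<close>.
  The truncation \<open>W = min 1 V\<close> satisfies it everywhere, because \<open>W\<close> cannot grow where it is already
  equal to 1; thus no stopping time is needed, and Markov's inequality concludes.
\<close>

section \<open>The differential equation method\<close>

text \<open>Unrolling the recursion gives a geometric sum. Bounding each of its terms by
  \<open>(1 + \<alpha>) ^ m\<close> avoids a division by \<open>\<alpha>\<close>, so
  \<open>\<alpha> = 0\<close> is covered, and \<open>1 + \<alpha> \<le> exp \<alpha>\<close> then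
  yields the exponential.\<close>

lemma discrete_gronwall:
  fixes a :: "nat \<Rightarrow> real"
  assumes "a 0 \<le> 0" "0 \<le> \<alpha>" "0 \<le> \<beta>"
    and step: "\<And>m. m < M \<Longrightarrow> a (Suc m) \<le> (1 + \<alpha>) * a m + \<beta>"
  shows "a M \<le> real M * \<beta> * exp (\<alpha> * real M)"
proof -
  have "a m \<le> real m * \<beta> * (1 + \<alpha>) ^ m" if "m \<le> M" for m
    using that
  proof (induction m)
    case 0
    then show ?case using assms by simp
  next
    case (Suc m)
    have "a (Suc m) \<le> (1 + \<alpha>) * a m + \<beta>" using step Suc.prems by simp
    also have "\<dots> \<le> (1 + \<alpha>) * (real m * \<beta> * (1 + \<alpha>) ^ m) + \<beta> * (1 + \<alpha>) ^ Suc m"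
    proof (intro add_mono mult_left_mono)
      have "1 \<le> (1 + \<alpha>) ^ Suc m" using assms by (intro one_le_power) simp
      then show "\<beta> \<le> \<beta> * (1 + \<alpha>) ^ Suc m" using assms by (metis mult.right_neutral mult_left_mono)
    qed (use Suc assms in auto)
    also have "\<dots> = real (Suc m) * \<beta> * (1 + \<alpha>) ^ Suc m" by (simp add: algebra_simps)
    finally show ?case .
  qed
  then have "a M \<le> real M * \<beta> * (1 + \<alpha>) ^ M" by simp
  also have "(1 + \<alpha>) ^ M \<le> exp \<alpha> ^ M"
    using assms exp_ge_add_one_self[of \<alpha>] by (intro power_mono) auto
  also have "exp \<alpha> ^ M = exp (\<alpha> * real M)" by (metis exp_of_nat2_mult)
  finally show ?thesis using assms by (simp add: mult_left_mono)
qed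

text \<open>A drift error and a second moment of size \<open>\<eta> n / n\<close> per round add up
  to O(\<open>\<eta> n\<close>) over the O(n) rounds up to time \<open>t\<close>. Lipschitz, drift
  and jump bounds are demanded only in the box of radius \<open>B + 1\<close>: the solution stays
  within radius \<open>B\<close>, and the bounds are needed only while every coordinate is within 1
  of it.\<close>

lemma differential_equation_method:
  fixes P :: "nat \<Rightarrow> nat \<Rightarrow> 'a pmf" and step :: "nat \<Rightarrow> 'a \<Rightarrow> 'a pmf"
    and J :: "'j set" and Y :: "'j \<Rightarrow> nat \<Rightarrow> 'a \<Rightarrow> real"
    and y :: "'j \<Rightarrow> real \<Rightarrow> real" and F :: "'j \<Rightarrow> ('j \<Rightarrow> real) \<Rightarrow> real"
  assumes P0: "\<And>n. P n 0 = return_pmf (start n)"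
    and PSuc: "\<And>n m. P n (Suc m) = bind_pmf (P n m) (step n)"
    and fin_step: "\<And>n G. finite (set_pmf (step n G))"
    and J: "finite J" and t: "0 \<le> t"
    and init: "\<And>n j. 0 < n \<Longrightarrow> j \<in> J \<Longrightarrow> Y j n (start n) = y j 0"
    and ode: "\<And>j u. j \<in> J \<Longrightarrow> 0 \<le> u \<Longrightarrow> u \<le> t \<Longrightarrow>
        (y j has_real_derivative F j (\<lambda>i. y i u)) (at u within {0..t})"
    and B: "0 \<le> B" "\<And>j u. j \<in> J \<Longrightarrow> 0 \<le> u \<Longrightarrow> u \<le> t \<Longrightarrow> \<bar>y j u\<bar> \<le> B"
    and K: "0 \<le> K"
    and lip: "\<And>j z z'. j \<in> J \<Longrightarrow> \<forall>i\<in>J. \<bar>z i\<bar> \<le> B + 1 \<Longrightarrow> \<forall>i\<in>J. \<bar>z' i\<bar> \<le> B + 1 \<Longrightarrow>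
        \<bar>F j z - F j z'\<bar> \<le> K * (\<Sum>i\<in>J. \<bar>z i - z' i\<bar>)"
    and drift: "\<And>n m G j. 2 \<le> n \<Longrightarrow> G \<in> set_pmf (P n m) \<Longrightarrow> j \<in> J \<Longrightarrow>
        \<forall>i\<in>J. \<bar>Y i n G\<bar> \<le> B + 1 \<Longrightarrow>
        \<bar>measure_pmf.expectation (step n G) (\<lambda>H. Y j n H - Y j n G)
          - 2 / real n * F j (\<lambda>i. Y i n G)\<bar> \<le> \<eta> n / real n"
    and jump: "\<And>n m G j. 2 \<le> n \<Longrightarrow> G \<in> set_pmf (P n m) \<Longrightarrow> j \<in> J \<Longrightarrow>
        \<forall>i\<in>J. \<bar>Y i n G\<bar> \<le> B + 1 \<Longrightarrow>
        measure_pmf.expectation (step n G) (\<lambda>H. (Y j n H - Y j n G)\<^sup>2) \<le> \<eta> n / real n"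
    and \<eta>: "\<And>n. 0 \<le> \<eta> n" "\<eta> \<longlonglongrightarrow> 0"
    and j: "j \<in> J"
  shows "conv_in_prob (\<lambda>n. P n (nat \<lfloor>real n * t / 2\<rfloor>)) (Y j) (y j t)"
proof -
  define c where "c = real (card J)"
  \<comment> \<open>\<open>R\<close> bounds every \<open>F j\<close> along the solution, by
    comparison with its value at the origin, and is therefore a Lipschitz constant of each
    \<open>y j\<close>.\<close>
  define R where "R = (\<Sum>j\<in>J. \<bar>F j (\<lambda>_. 0)\<bar>) + K * (c * B)"
  define V where "V n m G = (\<Sum>j\<in>J. (Y j n G - y j (2 * real m / real n))\<^sup>2)" for n m G
  define W where "W n m G = min 1 (V n m G)" for n m G
  \<comment> \<open>\<open>\<kappa> n / n\<close> collects the part of the one-round error that is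
    not proportional to \<open>V\<close>: the term in \<open>\<eta>\<close> comes from drift and
    jump, the terms in \<open>R\<close> from the movement of the solution during a time step
    \<open>2 / n\<close>.\<close>
  define \<kappa> where "\<kappa> n = 4 * c * \<eta> n + (8 * K * c\<^sup>2 * R + 8 * c * R\<^sup>2) / real n" for n
  define M where "M n = nat \<lfloor>real n * t / 2\<rfloor>" for n
  have c0: "0 \<le> c" by (simp add: c_def)
  have R0: "0 \<le> R" unfolding R_def using K B c0 by (intro add_nonneg_nonneg sum_nonneg mult_nonneg_nonneg) auto
  have \<kappa>0: "0 \<le> \<kappa> n" for n unfolding \<kappa>_def using K c0 R0 \<eta> by auto
  have M_le: "2 * real (M n) / real n \<le> t" if "0 < n" for n
  proof -
    have "real (M n) \<le> real n * t / 2" unfolding M_def using t by (intro of_nat_floor) simp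
    then show ?thesis using that by (simp add: field_simps)
  qed
  have yB: "\<bar>y i u\<bar> \<le> B + 1" if "i \<in> J" "0 \<le> u" "u \<le> t" for i u
    using B(2)[OF that] by linarith
  have F_bound: "\<bar>F j (\<lambda>i. y i u)\<bar> \<le> R" if "j \<in> J" "0 \<le> u" "u \<le> t" for j u
  proof -
    have "\<bar>F j (\<lambda>i. y i u) - F j (\<lambda>_. 0)\<bar> \<le> K * (\<Sum>i\<in>J. \<bar>y i u - 0\<bar>)"
      using B(1) that by (intro lip) (auto intro: yB)
    also have "\<dots> \<le> K * (\<Sum>i\<in>J. B)" using B that K by (intro mult_left_mono sum_mono) auto
    finally have "\<bar>F j (\<lambda>i. y i u) - F j (\<lambda>_. 0)\<bar> \<le> K * (c * B)" by (simp add: c_def)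
    moreover have "\<bar>F j (\<lambda>_. 0)\<bar> \<le> (\<Sum>j\<in>J. \<bar>F j (\<lambda>_. 0)\<bar>)"
      using J that by (intro member_le_sum) auto
    ultimately show ?thesis unfolding R_def by linarith
  qed
  have mvt: "\<exists>\<xi>. u < \<xi> \<and> \<xi> < u' \<and> y j u' - y j u = (u' - u) * F j (\<lambda>i. y i \<xi>)"
    if "j \<in> J" "0 \<le> u" "u < u'" "u' \<le> t" for j u u'
  proof -
    have "\<exists>\<xi>\<in>{u<..<u'}. y j u' - y j u = F j (\<lambda>i. y i \<xi>) * (u' - u)"
    proof (rule mvt_simple[OF \<open>u < u'\<close>])
      fix v assume "u \<le> v" "v \<le> u'"
      then have "(y j has_real_derivative F j (\<lambda>i. y i v)) (at v within {u..u'})"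
        using that by (intro has_field_derivative_subset[OF ode]) auto
      then show "(y j has_derivative (*) (F j (\<lambda>i. y i v))) (at v within {u..u'})"
        by (simp add: has_field_derivative_def)
    qed
    then obtain \<xi> where "\<xi> \<in> {u<..<u'}" "y j u' - y j u = F j (\<lambda>i. y i \<xi>) * (u' - u)" ..
    then show ?thesis by (intro exI[of _ \<xi>]) (auto simp: mult.commute)
  qed
  have y_lip: "\<bar>y j u' - y j u\<bar> \<le> R * (u' - u)" if asm: "j \<in> J" "0 \<le> u" "u \<le> u'" "u' \<le> t" for j u u'
  proof (cases "u = u'")
    case False
    then obtain \<xi> where "u < \<xi>" "\<xi> < u'" "y j u' - y j u = (u' - u) * F j (\<lambda>i. y i \<xi>)"
      using mvt[of j u u'] asm by auto
    then show ?thesis using F_bound[of j \<xi>] asm False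
      by (simp add: abs_mult mult.commute mult_right_mono)
  qed simp
  have W01: "0 \<le> W n m G" "W n m G \<le> 1" for n m G
    by (auto simp: W_def V_def intro: sum_nonneg)
  have one_step: "measure_pmf.expectation (step n G) (W n (Suc m))
      \<le> (1 + 4 * K * c / real n) * W n m G + \<kappa> n / real n"
    if n: "2 \<le> n" and m: "m < M n" and G: "G \<in> set_pmf (P n m)" for n m G
  proof (cases "V n m G < 1")
    case False
    have "measure_pmf.expectation (step n G) (W n (Suc m)) \<le> 1"
      by (rule measure_pmf.integral_le_const[OF integrable_measure_pmf_finite[OF fin_step]])
        (simp add: W01)
    also have "1 \<le> (1 + 4 * K * c / real n) * 1 + \<kappa> n / real n"
      using K c0 \<kappa>0[of n] by simp
    finally show ?thesis using False by (simp add: W_def)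
  next
    case True
    define u where "u = 2 * real m / real n"
    define u' where "u' = 2 * real (Suc m) / real n"
    \<comment> \<open>The new deviation is \<open>d j + Z j H - \<delta> j\<close>: the old
      deviation plus the random increment minus the increment of the solution.\<close>
    define d where "d j = Y j n G - y j u" for j
    define Z where "Z j H = Y j n H - Y j n G" for j H
    define \<delta> where "\<delta> j = y j u' - y j u" for j
    let ?E = "measure_pmf.expectation (step n G)"
    have int: "integrable (measure_pmf (step n G)) f" for f :: "'a \<Rightarrow> real"
      by (rule integrable_measure_pmf_finite[OF fin_step])
    have u: "0 \<le> u" "u < u'" "u' - u = 2 / real n" "u' \<le> t"
    proof -
      show "0 \<le> u" "u < u'" "u' - u = 2 / real n" using n by (auto simp: u_def u'_def field_simps)
      have "u' \<le> 2 * real (M n) / real n" unfolding u'_def using m by (intro divide_right_mono) auto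
      then show "u' \<le> t" using M_le[of n] n by simp
    qed
    have Vd: "V n m G = (\<Sum>j\<in>J. (d j)\<^sup>2)" by (simp add: V_def d_def u_def)
    have d1: "\<bar>d j\<bar> \<le> 1" if "j \<in> J" for j
    proof -
      have "(d j)\<^sup>2 \<le> V n m G" unfolding Vd using J that by (intro member_le_sum) auto
      then show ?thesis using True by (simp add: abs_square_le_1[symmetric])
    qed
    \<comment> \<open>Since \<open>V < 1\<close>, every coordinate is within 1 of the solution; this
      puts the state into the box where \<open>lip\<close>, \<open>drift\<close> and
      \<open>jump\<close> apply.\<close>
    have YB: "\<forall>i\<in>J. \<bar>Y i n G\<bar> \<le> B + 1"
    proof
      fix i assume "i \<in> J"
      then have "\<bar>y i u\<bar> \<le> B" "\<bar>Y i n G - y i u\<bar> \<le> 1" using B u d1 by (auto simp: d_def)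
      then show "\<bar>Y i n G\<bar> \<le> B + 1" by linarith
    qed
    have yB': "\<forall>i\<in>J. \<bar>y i v\<bar> \<le> B + 1" if "u \<le> v" "v \<le> u'" for v
      using u that by (auto intro: yB)
    \<comment> \<open>Three errors add up: the drift hypothesis, the change of \<open>F\<close> from
      the state to the solution at time \<open>u\<close>, and its change along the solution from
      \<open>u\<close> to the mean value point \<open>\<xi>\<close>, which is less than
      \<open>2 / n\<close> away.\<close>
    have mean: "\<bar>?E (Z j) - \<delta> j\<bar>
        \<le> \<eta> n / real n + 2 / real n * (K * (\<Sum>i\<in>J. \<bar>d i\<bar>)) + 4 / (real n)\<^sup>2 * (K * (c * R))"
      if jJ: "j \<in> J" for j
    proof -
      obtain \<xi> where \<xi>: "u < \<xi>" "\<xi> < u'" "\<delta> j = 2 / real n * F j (\<lambda>i. y i \<xi>)"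
        using mvt[of j u u'] jJ u unfolding \<delta>_def by auto
      have "\<bar>?E (Z j) - 2 / real n * F j (\<lambda>i. Y i n G)\<bar> \<le> \<eta> n / real n"
        unfolding Z_def by (rule drift[OF n G that YB])
      moreover have "\<bar>2 / real n * F j (\<lambda>i. Y i n G) - 2 / real n * F j (\<lambda>i. y i u)\<bar>
          \<le> 2 / real n * (K * (\<Sum>i\<in>J. \<bar>d i\<bar>))"
        using lip[OF that YB yB'[of u]] u unfolding right_diff_distrib[symmetric] abs_mult d_def
        by (intro mult_mono) auto
      moreover have "\<bar>2 / real n * F j (\<lambda>i. y i u) - \<delta> j\<bar> \<le> 4 / (real n)\<^sup>2 * (K * (c * R))"
      proof -
        have "\<bar>F j (\<lambda>i. y i u) - F j (\<lambda>i. y i \<xi>)\<bar> \<le> K * (\<Sum>i\<in>J. \<bar>y i u - y i \<xi>\<bar>)"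
          using lip[OF that yB'[of u] yB'[of \<xi>]] u \<xi> by auto
        also have "\<dots> \<le> K * (\<Sum>i\<in>J. R * (2 / real n))"
        proof (intro mult_left_mono sum_mono)
          fix i assume "i \<in> J"
          then have "\<bar>y i u - y i \<xi>\<bar> \<le> R * (\<xi> - u)"
            using y_lip[of i u \<xi>] u \<xi> by (simp add: abs_minus_commute)
          also have "\<dots> \<le> R * (2 / real n)" using R0 u \<xi> by (intro mult_left_mono) auto
          finally show "\<bar>y i u - y i \<xi>\<bar> \<le> R * (2 / real n)" .
        qed (use K in auto)
        finally have *: "\<bar>F j (\<lambda>i. y i u) - F j (\<lambda>i. y i \<xi>)\<bar> \<le> K * (c * (R * (2 / real n)))"
          by (simp add: c_def)
        have "\<bar>2 / real n * F j (\<lambda>i. y i u) - \<delta> j\<bar>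
            = 2 / real n * \<bar>F j (\<lambda>i. y i u) - F j (\<lambda>i. y i \<xi>)\<bar>"
          unfolding \<xi> right_diff_distrib[symmetric] abs_mult by simp
        also have "\<dots> \<le> 2 / real n * (K * (c * (R * (2 / real n))))"
          using * by (intro mult_left_mono) auto
        finally show ?thesis by (simp add: power2_eq_square mult_ac)
      qed
      ultimately show ?thesis by linarith
    qed
    have sq: "?E (\<lambda>H. (Y j n H - y j u')\<^sup>2) \<le> (d j)\<^sup>2
        + 2 * \<bar>d j\<bar> * (2 / real n * (K * (\<Sum>i\<in>J. \<bar>d i\<bar>)))
        + (4 * \<eta> n / real n + 8 / (real n)\<^sup>2 * (K * (c * R)) + 8 * R\<^sup>2 / (real n)\<^sup>2)"
      if "j \<in> J" for j
    proof -
      have "(Y j n H - y j u')\<^sup>2 \<le> (d j)\<^sup>2 + 2 * d j * (Z j H - \<delta> j) + 2 * (Z j H)\<^sup>2 + 2 * (\<delta> j)\<^sup>2" for H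
      proof -
        have eq: "Y j n H - y j u' = d j + Z j H - \<delta> j" by (simp add: d_def Z_def \<delta>_def)
        \<comment> \<open>This square gives
          \<open>(Z - \<delta>)^2 \<le> 2 Z^2 + 2 \<delta>^2\<close>, separating the random
          increment from the deterministic one.\<close>
        have "0 \<le> (Z j H + \<delta> j)\<^sup>2" by simp
        then show ?thesis unfolding eq by (simp add: power2_eq_square algebra_simps)
      qed
      then have "?E (\<lambda>H. (Y j n H - y j u')\<^sup>2)
          \<le> ?E (\<lambda>H. (d j)\<^sup>2 + 2 * d j * (Z j H - \<delta> j) + 2 * (Z j H)\<^sup>2 + 2 * (\<delta> j)\<^sup>2)"
        by (intro integral_mono int)
      also have "\<dots> = (d j)\<^sup>2 + 2 * d j * (?E (Z j) - \<delta> j) + 2 * ?E (\<lambda>H. (Z j H)\<^sup>2) + 2 * (\<delta> j)\<^sup>2"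
        by (simp add: int)
      finally have 1: "?E (\<lambda>H. (Y j n H - y j u')\<^sup>2)
        \<le> (d j)\<^sup>2 + 2 * d j * (?E (Z j) - \<delta> j) + 2 * ?E (\<lambda>H. (Z j H)\<^sup>2) + 2 * (\<delta> j)\<^sup>2" .
      have 2: "?E (\<lambda>H. (Z j H)\<^sup>2) \<le> \<eta> n / real n"
        unfolding Z_def by (rule jump[OF n G that YB])
      have "\<bar>\<delta> j\<bar> \<le> R * (2 / real n)" using y_lip[of j u u'] that u by (simp add: \<delta>_def)
      then have "(\<delta> j)\<^sup>2 \<le> (R * (2 / real n))\<^sup>2" by (metis abs_ge_zero power2_abs power_mono)
      then have 3: "(\<delta> j)\<^sup>2 \<le> 4 * R\<^sup>2 / (real n)\<^sup>2" by (simp add: power_mult_distrib power_divide mult.commute)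
      let ?e1 = "2 / real n * (K * (\<Sum>i\<in>J. \<bar>d i\<bar>))"
      let ?e2 = "\<eta> n / real n + 4 / (real n)\<^sup>2 * (K * (c * R))"
      have e2: "0 \<le> ?e2" using \<eta> K c0 R0 by auto
      have "d j * (?E (Z j) - \<delta> j) \<le> \<bar>d j\<bar> * \<bar>?E (Z j) - \<delta> j\<bar>"
        by (metis abs_ge_self abs_mult)
      also have "\<dots> \<le> \<bar>d j\<bar> * (?e1 + ?e2)" using mean[OF that] by (intro mult_left_mono) auto
      also have "\<dots> = \<bar>d j\<bar> * ?e1 + \<bar>d j\<bar> * ?e2" by (rule distrib_left)
      \<comment> \<open>The factor \<open>\<bar>d j\<bar> \<le> 1\<close> is dropped in front of the
        small error \<open>?e2\<close> but kept with \<open>?e1\<close>, whose sum over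
        \<open>j\<close> has to be quadratic in the deviations.\<close>
      also have "\<bar>d j\<bar> * ?e2 \<le> ?e2" using d1[OF that] e2 by (simp add: mult_left_le_one_le)
      finally have 4: "d j * (?E (Z j) - \<delta> j) \<le> \<bar>d j\<bar> * ?e1 + ?e2" by simp
      have "?E (\<lambda>H. (Y j n H - y j u')\<^sup>2)
          \<le> (d j)\<^sup>2 + 2 * (\<bar>d j\<bar> * ?e1 + ?e2) + 2 * (\<eta> n / real n) + 2 * (4 * R\<^sup>2 / (real n)\<^sup>2)"
        by (rule order_trans[OF 1[unfolded mult.assoc[of 2 "d j"]]])
          (intro 2 3 4 order_refl add_mono mult_left_mono; simp)
      also have "\<dots> = (d j)\<^sup>2 + 2 * \<bar>d j\<bar> * ?e1
          + (4 * \<eta> n / real n + 8 / (real n)\<^sup>2 * (K * (c * R)) + 8 * R\<^sup>2 / (real n)\<^sup>2)"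
        by (simp add: algebra_simps)
      finally show ?thesis .
    qed
    have "?E (W n (Suc m)) \<le> ?E (V n (Suc m))"
      by (intro integral_mono int) (simp add: W_def)
    also have "\<dots> = (\<Sum>j\<in>J. ?E (\<lambda>H. (Y j n H - y j u')\<^sup>2))"
      unfolding V_def u'_def by (rule Bochner_Integration.integral_sum) (rule int)
    also have "\<dots> \<le> (\<Sum>j\<in>J. (d j)\<^sup>2
        + 2 * \<bar>d j\<bar> * (2 / real n * (K * (\<Sum>i\<in>J. \<bar>d i\<bar>)))
        + (4 * \<eta> n / real n + 8 / (real n)\<^sup>2 * (K * (c * R)) + 8 * R\<^sup>2 / (real n)\<^sup>2))"
      by (intro sum_mono sq)
    also have "\<dots> = V n m G + 4 * K / real n * (\<Sum>i\<in>J. \<bar>d i\<bar>)\<^sup>2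
        + c * (4 * \<eta> n / real n + 8 / (real n)\<^sup>2 * (K * (c * R)) + 8 * R\<^sup>2 / (real n)\<^sup>2)"
      unfolding sum.distrib Vd c_def sum_constant sum_distrib_right[symmetric] sum_distrib_left[symmetric]
      by (simp add: power2_eq_square algebra_simps)
    also have "c * (4 * \<eta> n / real n + 8 / (real n)\<^sup>2 * (K * (c * R)) + 8 * R\<^sup>2 / (real n)\<^sup>2) = \<kappa> n / real n"
      by (simp add: \<kappa>_def power2_eq_square add_divide_distrib algebra_simps)
    \<comment> \<open>Cauchy-Schwarz turns the squared sum into a multiple of \<open>V\<close>,
      which the Gronwall factor absorbs.\<close>
    also have "(\<Sum>i\<in>J. \<bar>d i\<bar>)\<^sup>2 \<le> c * V n m G"
      unfolding Vd c_def using sum_squared_le_sum_of_squares[of "\<lambda>i. \<bar>d i\<bar>" J] by (simp add: mult.commute)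
    then have "V n m G + 4 * K / real n * (\<Sum>i\<in>J. \<bar>d i\<bar>)\<^sup>2 + \<kappa> n / real n
        \<le> V n m G + 4 * K / real n * (c * V n m G) + \<kappa> n / real n"
      using K by (intro add_mono mult_left_mono) auto
    finally have "?E (W n (Suc m)) \<le> (1 + 4 * K * c / real n) * V n m G + \<kappa> n / real n"
      by (simp add: algebra_simps)
    moreover have "W n m G = V n m G" using True by (simp add: W_def)
    ultimately show ?thesis by simp
  qed
  have fin_P: "finite (set_pmf (P n m))" for n m
    by (induction m) (auto simp: P0 PSuc fin_step)
  have recursion: "measure_pmf.expectation (P n (Suc m)) (W n (Suc m))
      \<le> (1 + 4 * K * c / real n) * measure_pmf.expectation (P n m) (W n m) + \<kappa> n / real n"
    if n: "2 \<le> n" and m: "m < M n" for n m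
  proof -
    have "measure_pmf.expectation (P n (Suc m)) (W n (Suc m))
        = (\<Sum>G\<in>set_pmf (P n m). pmf (P n m) G *\<^sub>R measure_pmf.expectation (step n G) (W n (Suc m)))"
      unfolding PSuc by (rule pmf_expectation_bind) (auto simp: fin_P fin_step)
    also have "\<dots> \<le> (\<Sum>G\<in>set_pmf (P n m). pmf (P n m) G *\<^sub>R
        ((1 + 4 * K * c / real n) * W n m G + \<kappa> n / real n))"
      by (intro sum_mono scaleR_left_mono one_step n m) auto
    also have "\<dots> = measure_pmf.expectation (P n m) (\<lambda>G. (1 + 4 * K * c / real n) * W n m G + \<kappa> n / real n)"
      by (subst integral_measure_pmf[of "set_pmf (P n m)"]) (auto simp: fin_P)
    also have "\<dots> = (1 + 4 * K * c / real n) * measure_pmf.expectation (P n m) (W n m) + \<kappa> n / real n"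
      by (simp add: integrable_measure_pmf_finite[OF fin_P])
    finally show ?thesis .
  qed
  have EW: "measure_pmf.expectation (P n (M n)) (W n (M n)) \<le> t / 2 * \<kappa> n * exp (2 * K * c * t)"
    if n: "2 \<le> n" for n
  proof -
    have W0: "W n 0 (start n) = 0"
      using n by (simp add: W_def V_def init)
    \<comment> \<open>At most \<open>n t / 2\<close> rounds take place, so the accumulated error is
      of order \<open>\<kappa> n\<close> and the exponent stays bounded in \<open>n\<close>.\<close>
    have tM: "real (M n) / real n \<le> t / 2" using M_le[of n] n by (simp add: mult.commute)
    have "measure_pmf.expectation (P n (M n)) (W n (M n))
        \<le> real (M n) * (\<kappa> n / real n) * exp (4 * K * c / real n * real (M n))"
      using recursion[OF n] K c0 \<kappa>0[of n] by (intro discrete_gronwall) (auto simp: P0 W0)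
    also have "\<dots> = (real (M n) / real n) * \<kappa> n * exp (4 * K * c * (real (M n) / real n))"
      by simp
    also have "\<dots> \<le> (t / 2) * \<kappa> n * exp (4 * K * c * (t / 2))"
    proof (intro mult_mono)
      show "exp (4 * K * c * (real (M n) / real n)) \<le> exp (4 * K * c * (t / 2))"
        unfolding exp_le_cancel_iff using tM K c0 by (intro mult_left_mono) auto
    qed (use tM t \<kappa>0[of n] in auto)
    finally show ?thesis by (simp add: mult.assoc)
  qed
  have "\<kappa> \<longlonglongrightarrow> 4 * c * 0 + 0"
    unfolding \<kappa>_def by (intro tendsto_add tendsto_mult tendsto_const \<eta> lim_const_over_n)
  then have "(\<lambda>n. t / 2 * \<kappa> n * exp (2 * K * c * t)) \<longlonglongrightarrow> t / 2 * 0 * exp (2 * K * c * t)"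
    by (intro tendsto_mult tendsto_const) simp
  then have bound0: "(\<lambda>n. t / 2 * \<kappa> n * exp (2 * K * c * t)) \<longlonglongrightarrow> 0" by simp
  show ?thesis unfolding conv_in_prob_def M_def[symmetric]
  proof (intro allI impI)
    fix \<epsilon> :: real assume \<epsilon>: "0 < \<epsilon>"
    \<comment> \<open>The threshold is cut at 1 because \<open>W\<close> never exceeds 1. Half of
      \<open>\<epsilon>\<close> is spent on the deviation at the grid time \<open>u\<close> of the
      last round; the other half pays for the difference of \<open>y j\<close> between
      \<open>u\<close> and \<open>t\<close>, which the floor keeps below
      \<open>R * (2 / n)\<close>.\<close>
    define \<theta> where "\<theta> = min 1 ((\<epsilon> / 2)\<^sup>2)"
    have \<theta>: "0 < \<theta>" using \<epsilon> by (simp add: \<theta>_def)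
    have "(\<lambda>n. R * (2 / real n)) \<longlonglongrightarrow> R * 0"
      by (intro tendsto_mult tendsto_const lim_const_over_n)
    then have "\<forall>\<^sub>F n in sequentially. R * (2 / real n) < \<epsilon> / 2"
      using \<epsilon> by (intro order_tendstoD(2)) auto
    moreover have "\<forall>\<^sub>F n in sequentially. (2::nat) \<le> n" by (rule eventually_ge_at_top)
    ultimately have "\<forall>\<^sub>F n in sequentially.
        norm (measure_pmf.prob (P n (M n)) {a. \<bar>Y j n a - y j t\<bar> > \<epsilon>})
        \<le> (t / 2 * \<kappa> n * exp (2 * K * c * t)) / \<theta>"
    proof eventually_elim
      case (elim n)
      define u where "u = 2 * real (M n) / real n"
      have u: "0 \<le> u" "u \<le> t" "t - u \<le> 2 / real n"
      proof -
        show "0 \<le> u" by (simp add: u_def)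
        show "u \<le> t" unfolding u_def using elim by (intro M_le) simp
        have "real n * t / 2 - 1 \<le> real (M n)" unfolding M_def using t by linarith
        then have "t \<le> (2 + 2 * real (M n)) / real n"
          using elim(2) by (simp add: pos_le_divide_eq mult.commute)
        then show "t - u \<le> 2 / real n" unfolding u_def add_divide_distrib by simp
      qed
      have yy: "\<bar>y j t - y j u\<bar> \<le> \<epsilon> / 2"
      proof -
        have "\<bar>y j t - y j u\<bar> \<le> R * (t - u)" using y_lip[OF j] u t by auto
        also have "\<dots> \<le> R * (2 / real n)" using u R0 by (intro mult_left_mono)
        finally show ?thesis using elim by simp
      qed
      have "{a. \<bar>Y j n a - y j t\<bar> > \<epsilon>} \<subseteq> {a \<in> space (measure_pmf (P n (M n))). W n (M n) a \<ge> \<theta>}"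
      proof safe
        fix a assume "\<bar>Y j n a - y j t\<bar> > \<epsilon>"
        then have "\<bar>Y j n a - y j u\<bar> \<ge> \<epsilon> / 2" using yy by linarith
        then have "(\<epsilon> / 2)\<^sup>2 \<le> (Y j n a - y j u)\<^sup>2"
          using \<epsilon> by (metis abs_le_square_iff abs_of_pos half_gt_zero)
        also have "\<dots> \<le> V n (M n) a" unfolding V_def u_def using J j
          by (intro member_le_sum[of j J "\<lambda>j. (Y j n a - y j (2 * real (M n) / real n))\<^sup>2"]) auto
        finally show "\<theta> \<le> W n (M n) a" unfolding \<theta>_def W_def by linarith
      qed simp
      then have "measure_pmf.prob (P n (M n)) {a. \<bar>Y j n a - y j t\<bar> > \<epsilon>}
          \<le> measure_pmf.prob (P n (M n)) {a \<in> space (measure_pmf (P n (M n))). W n (M n) a \<ge> \<theta>}"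
        by (intro measure_pmf.finite_measure_mono) auto
      also have "\<dots> \<le> measure_pmf.expectation (P n (M n)) (W n (M n)) / \<theta>"
        by (intro integral_Markov_inequality_measure[where A = "{}"])
          (auto simp: integrable_measure_pmf_finite[OF fin_P] W01 \<theta>)
      also have "\<dots> \<le> (t / 2 * \<kappa> n * exp (2 * K * c * t)) / \<theta>"
        using EW[of n] elim \<theta> by (intro divide_right_mono) auto
      finally show ?case by simp
    qed
    moreover have "(\<lambda>n. (t / 2 * \<kappa> n * exp (2 * K * c * t)) / \<theta>) \<longlonglongrightarrow> 0"
      using tendsto_divide[OF bound0 tendsto_const[of \<theta>]] \<theta> by simp
    ultimately show "(\<lambda>n. measure_pmf.prob (P n (M n)) {a. \<bar>Y j n a - y j t\<bar> > \<epsilon>}) \<longlonglongrightarrow> 0"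
      by (rule Lim_null_comparison)
  qed
qed

section \<open>Components and the addition of an edge\<close>

lemma sym_adj_rtrancl: "sym ((adj G)\<^sup>*)"
  by (rule sym_rtrancl) (auto simp: sym_def adj_def insert_commute)

lemma self_in_component: "v \<in> component G v"
  by (simp add: component_def)

lemma component_sym: "w \<in> component G v \<longleftrightarrow> v \<in> component G w"
  using sym_adj_rtrancl[of G] by (auto simp: component_def sym_def)

lemma component_eq_iff: "component G v = component G w \<longleftrightarrow> w \<in> component G v"
proof
  show "component G v = component G w \<Longrightarrow> w \<in> component G v"
    by (simp add: self_in_component)
next
  assume "w \<in> component G v"
  then have vw: "(v, w) \<in> (adj G)\<^sup>*" "(w, v) \<in> (adj G)\<^sup>*"
    using component_sym[of w G v] by (auto simp: component_def)
  then show "component G v = component G w"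
    by (auto simp: component_def intro: rtrancl_trans)
qed

lemma component_disjoint:
  "component G v \<noteq> component G w \<Longrightarrow> component G v \<inter> component G w = {}"
  using component_eq_iff by blast

text \<open>The adjacency relation gains just the pairs (v, w) and (w, v), so any newly connected
  pair of vertices is joined through these two components. The formula stays correct when they
  coincide.\<close>

lemma component_insert:
  "component (insert {v, w} G) u =
    (if u \<in> component G v \<union> component G w then component G v \<union> component G w else component G u)"
proof -
  have "adj (insert {v, w} G) = insert (v, w) (insert (w, v) (adj G))"
    by (auto simp: adj_def doubleton_eq_iff)
  then have "component (insert {v, w} G) u = component G u
      \<union> (if v \<in> component G u then component G w else {})
      \<union> (if w \<in> component G u then component G v else {})"
    by (auto simp: component_def rtrancl_insert dest: rtrancl_trans)
  moreover have "v \<in> component G u \<longleftrightarrow> u \<in> component G v" "w \<in> component G u \<longleftrightarrow> u \<in> component G w"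
    by (auto simp: component_sym)
  moreover have "u \<in> component G v \<Longrightarrow> component G u = component G v"
    "u \<in> component G w \<Longrightarrow> component G u = component G w"
    using component_eq_iff by blast+
  ultimately show ?thesis by auto
qed

lemma component_subset:
  assumes "G \<subseteq> all_edges n" "v < n"
  shows "component G v \<subseteq> {..<n}"
proof
  fix w assume "w \<in> component G v"
  then have "(v, w) \<in> (adj G)\<^sup>*" by (simp add: component_def)
  then show "w \<in> {..<n}"
  proof (induction rule: rtrancl_induct)
    case (step y z)
    then have "{y, z} \<in> all_edges n" using assms by (auto simp: adj_def)
    then show ?case by (auto simp: all_edges_def doubleton_eq_iff)
  qed (simp add: assms)
qed

lemma finite_component: "G \<subseteq> all_edges n \<Longrightarrow> v < n \<Longrightarrow> finite (component G v)"
  by (rule finite_subset[OF component_subset]) auto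

lemma card_component_pos: "G \<subseteq> all_edges n \<Longrightarrow> v < n \<Longrightarrow> 0 < card (component G v)"
  using finite_component[of G n v] self_in_component[of v G] by (auto simp: card_gt_0_iff)

text \<open>This turns the edge condition of the acceptance rule into a condition on component
  sizes. The direction from size one to isolation uses that edges of \<open>all_edges n\<close> are
  not loops.\<close>

lemma isolated_iff_card_component:
  assumes "G \<subseteq> all_edges n" "v < n"
  shows "isolated G v \<longleftrightarrow> card (component G v) = 1"
proof
  assume iso: "isolated G v"
  have "w = v" if "(v, w) \<in> (adj G)\<^sup>*" for w
    using that by (rule converse_rtranclE) (use iso in \<open>auto simp: adj_def isolated_def\<close>)
  then have "component G v = {v}" by (auto simp: component_def)
  then show "card (component G v) = 1" by simp
next
  assume card: "card (component G v) = 1"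
  show "isolated G v" unfolding isolated_def
  proof (intro ballI notI)
    fix e assume e: "e \<in> G" "v \<in> e"
    then obtain w where w: "e = {v, w}" "w \<noteq> v"
      using assms by (auto simp: all_edges_def)
    then have "w \<in> component G v" using e by (auto simp: component_def adj_def)
    then have "component G v \<noteq> {v}" using w by auto
    then show False using card self_in_component[of v G] by (metis card_1_singletonE singletonD)
  qed
qed

section \<open>Sums over components and their change when two components merge\<close>

definition comp_sum :: "(nat \<Rightarrow> real) \<Rightarrow> nat \<Rightarrow> nat set set \<Rightarrow> real" where
  "comp_sum f n G = (\<Sum>C\<in>components n G. f (card C))"

definition merge_gain :: "(nat \<Rightarrow> real) \<Rightarrow> nat \<Rightarrow> nat \<Rightarrow> real" where
  "merge_gain f a b = f (a + b) - f a - f b"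

lemma finite_components: "finite (components n G)"
  by (simp add: components_def)

text \<open>This covers all four statistics at once: \<open>f a = a ^ k\<close> gives n times
  \<open>s_k\<close>, and the indicator of \<open>a = 1\<close> counts the isolated vertices. Only
  the two components that are joined are affected.\<close>

lemma comp_sum_insert:
  assumes G: "G \<subseteq> all_edges n" and v: "v < n" and w: "w < n"
  shows "comp_sum f n (insert {v, w} G) - comp_sum f n G =
    (if component G v = component G w then 0
     else merge_gain f (card (component G v)) (card (component G w)))"
proof (cases "component G v = component G w")
  case True
  have "u \<in> component G w \<Longrightarrow> component G w = component G u" for u
    using component_eq_iff by blast
  then have "component (insert {v, w} G) u = component G u" for u
    unfolding component_insert True by simp
  then show ?thesis using True by (simp add: comp_sum_def components_def)
next
  case False
  let ?A = "component G v" and ?B = "component G w"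
  have "components n (insert {v, w} G) = insert (?A \<union> ?B) (components n G - {?A, ?B})"
  proof (intro equalityI subsetI)
    fix C assume "C \<in> components n (insert {v, w} G)"
    then obtain u where "u < n" "C = component (insert {v, w} G) u" by (auto simp: components_def)
    then show "C \<in> insert (?A \<union> ?B) (components n G - {?A, ?B})"
      unfolding component_insert components_def using self_in_component[of u G] by auto
  next
    fix C assume "C \<in> insert (?A \<union> ?B) (components n G - {?A, ?B})"
    then consider "C = ?A \<union> ?B" | u where "u < n" "C = component G u" "C \<noteq> ?A" "C \<noteq> ?B"
      by (auto simp: components_def)
    then show "C \<in> components n (insert {v, w} G)"
    proof cases
      case 1
      then have "C = component (insert {v, w} G) v"
        by (simp add: component_insert self_in_component)
      then show ?thesis using v by (auto simp: components_def)
    next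
      case 2
      then have "u \<notin> ?A \<union> ?B" using component_eq_iff by blast
      then have "C = component (insert {v, w} G) u" using 2 by (simp add: component_insert)
      then show ?thesis using 2 by (auto simp: components_def)
    qed
  qed
  \<comment> \<open>Components form a set, so the union is a new summand only if it is not there
    already; a component equal to it would contain \<open>v\<close> and hence be
    \<open>?A\<close>.\<close>
  moreover have "?A \<union> ?B \<notin> components n G - {?A, ?B}"
  proof
    assume *: "?A \<union> ?B \<in> components n G - {?A, ?B}"
    then obtain u where u: "?A \<union> ?B = component G u" by (auto simp: components_def)
    then have "v \<in> component G u" using self_in_component[of v G] by auto
    then show False using * u component_eq_iff by (metis DiffE insertI1)
  qed
  moreover have "card (?A \<union> ?B) = card ?A + card ?B"
    using False G v w by (intro card_Un_disjoint component_disjoint finite_component) auto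
  moreover have "(\<Sum>C\<in>components n G - {?A, ?B}. f (card C))
      = (\<Sum>C\<in>components n G. f (card C)) - (f (card ?A) + f (card ?B))"
    using False v w by (subst sum_diff) (auto simp: finite_components, auto simp: components_def)
  ultimately show ?thesis
    using False by (simp add: comp_sum_def finite_components merge_gain_def)
qed

text \<open>Vertices are grouped by component, and a component of size a is met a times. The effect
  is a shift of exponents: the k-th moment of component sizes over vertices is the component sum
  with exponent k + 1.\<close>

lemma sum_vertices:
  assumes "G \<subseteq> all_edges n"
  shows "(\<Sum>v<n. h (card (component G v))) = comp_sum (\<lambda>a. real a * h a) n G"
proof -
  have "(\<Sum>v<n. h (card (component G v)))
      = (\<Sum>C\<in>component G ` {..<n}. \<Sum>v\<in>{v \<in> {..<n}. component G v = C}. h (card (component G v)))"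
    by (rule sum.image_gen) simp
  also have "\<dots> = (\<Sum>C\<in>component G ` {..<n}. real (card C) * h (card C))"
  proof (rule sum.cong)
    fix C assume "C \<in> component G ` {..<n}"
    then obtain u where u: "u < n" "C = component G u" by auto
    have "{v \<in> {..<n}. component G v = C} = C"
      using component_subset[OF assms u(1)] u component_eq_iff[of G] component_sym[of _ G u] by auto
    moreover have "(\<Sum>v\<in>{v \<in> {..<n}. component G v = C}. h (card (component G v)))
        = (\<Sum>v\<in>{v \<in> {..<n}. component G v = C}. h (card C))"
      by (intro sum.cong) auto
    ultimately show "(\<Sum>v\<in>{v \<in> {..<n}. component G v = C}. h (card (component G v)))
        = real (card C) * h (card C)"
      by simp
  qed simp
  finally show ?thesis by (simp add: comp_sum_def components_def)
qed

section \<open>Averages over a random edge and the law of one round\<close>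

lemma finite_all_edges: "finite (all_edges n)"
  by (rule finite_subset[of _ "Pow {..<n}"]) (auto simp: all_edges_def)

text \<open>Every edge comes from exactly two ordered pairs. Edge averages thereby become double
  sums over vertices, which can be factored into moments.\<close>

lemma sum_ordered_pairs:
  fixes \<phi> :: "nat set \<Rightarrow> real"
  shows "(\<Sum>v<n. \<Sum>w\<in>{..<n} - {v}. \<phi> {v, w}) = 2 * (\<Sum>e\<in>all_edges n. \<phi> e)"
proof -
  let ?S = "SIGMA v:{..<n}. {..<n} - {v}"
  let ?e = "\<lambda>(v, w). {v, w} :: nat set"
  have img: "?e ` ?S = all_edges n"
    by (force simp: all_edges_def image_iff)
  have "(\<Sum>v<n. \<Sum>w\<in>{..<n} - {v}. \<phi> {v, w}) = (\<Sum>x\<in>?S. \<phi> (?e x))"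
    by (simp add: sum.Sigma case_prod_beta)
  also have "\<dots> = (\<Sum>e\<in>?e ` ?S. \<Sum>x\<in>{x \<in> ?S. ?e x = e}. \<phi> (?e x))"
    by (rule sum.image_gen) auto
  also have "\<dots> = (\<Sum>e\<in>?e ` ?S. 2 * \<phi> e)"
  proof (rule sum.cong)
    fix e assume "e \<in> ?e ` ?S"
    then obtain a b where ab: "a < n" "b < n" "a \<noteq> b" "e = {a, b}" by auto
    then have "{x \<in> ?S. ?e x = e} = {(a, b), (b, a)}" by (auto simp: doubleton_eq_iff)
    then show "(\<Sum>x\<in>{x \<in> ?S. ?e x = e}. \<phi> (?e x)) = 2 * \<phi> e"
      using ab by (simp add: insert_commute)
  qed simp
  finally show ?thesis by (simp add: img sum_distrib_left)
qed

lemma card_all_edges: "2 * real (card (all_edges n)) = real n * (real n - 1)"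
proof -
  have "(\<Sum>v<n. \<Sum>w\<in>{..<n} - {v}. (1::real)) = real n * (real n - 1)"
    by (cases n) (auto simp: algebra_simps)
  then show ?thesis using sum_ordered_pairs[of "\<lambda>_. 1" n] by simp
qed

definition edge_avg :: "nat \<Rightarrow> (nat set \<Rightarrow> real) \<Rightarrow> real" where
  "edge_avg n \<phi> = (\<Sum>e\<in>all_edges n. \<phi> e) / real (card (all_edges n))"

lemma edge_avg_pairs:
  "edge_avg n \<phi> = (\<Sum>v<n. \<Sum>w\<in>{..<n} - {v}. \<phi> {v, w}) / (real n * (real n - 1))"
  unfolding edge_avg_def sum_ordered_pairs card_all_edges[symmetric] by simp

lemma edge_avg_mono: "(\<And>e. e \<in> all_edges n \<Longrightarrow> \<phi> e \<le> \<psi> e) \<Longrightarrow> edge_avg n \<phi> \<le> edge_avg n \<psi>"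
  unfolding edge_avg_def by (intro divide_right_mono sum_mono) auto

lemma edge_avg_nonneg: "(\<And>e. e \<in> all_edges n \<Longrightarrow> 0 \<le> \<phi> e) \<Longrightarrow> 0 \<le> edge_avg n \<phi>"
  unfolding edge_avg_def by (intro divide_nonneg_nonneg sum_nonneg) auto

lemma all_edges_nonempty: "2 \<le> n \<Longrightarrow> all_edges n \<noteq> {}"
  using card_all_edges[of n] by auto

lemma finite_set_bf_step: "finite (set_pmf (bf_step n G))"
proof (cases "n < 2")
  case False
  then show ?thesis using all_edges_nonempty[of n]
    by (simp add: bf_step_def set_pmf_of_set finite_all_edges)
qed (simp add: bf_step_def)

lemma set_bf_subset: "G \<in> set_pmf (bf n m) \<Longrightarrow> G \<subseteq> all_edges n"
proof (induction m arbitrary: G)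
  case (Suc m)
  then obtain H where H: "H \<in> set_pmf (bf n m)" "G \<in> set_pmf (bf_step n H)" by auto
  then show ?case using Suc.IH[OF H(1)]
    by (cases "n < 2")
      (auto simp: bf_step_def finite_all_edges all_edges_nonempty split: if_splits)
qed simp

definition both_isolated :: "nat set set \<Rightarrow> nat set \<Rightarrow> bool" where
  "both_isolated G e \<longleftrightarrow> (\<forall>v\<in>e. isolated G v)"

text \<open>Condition on the first edge. If it is accepted, only it matters; if it is rejected, the
  second edge is still uniform and independent, so the rejection probability multiplies a plain edge
  average.\<close>

lemma expectation_bf_step:
  assumes "2 \<le> n"
  shows "measure_pmf.expectation (bf_step n G) h =
    edge_avg n (\<lambda>e. if both_isolated G e then h (insert e G) else 0)
    + (1 - edge_avg n (\<lambda>e. of_bool (both_isolated G e))) * edge_avg n (\<lambda>e. h (insert e G))"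
proof -
  let ?E = "all_edges n" and ?N = "real (card (all_edges n))"
  let ?a = "edge_avg n (\<lambda>e. h (insert e G))"
  note ne = all_edges_nonempty[OF assms]
  have N: "0 < ?N" using ne finite_all_edges by (simp add: card_gt_0_iff)
  have "measure_pmf.expectation (bf_step n G) h =
      (\<Sum>e1\<in>?E. (\<Sum>e2\<in>?E. h (if both_isolated G e1 then insert e1 G else insert e2 G) / ?N) / ?N)"
    using assms ne
    by (simp add: bf_step_def both_isolated_def pmf_expectation_bind_pmf_of_set finite_all_edges
        divide_inverse mult.commute)
  also have "\<dots> = (\<Sum>e1\<in>?E. (if both_isolated G e1 then h (insert e1 G) else 0) / ?N
      + (?a - of_bool (both_isolated G e1) * ?a) / ?N)"
    using N by (intro sum.cong) (auto simp: edge_avg_def sum_divide_distrib)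
  also have "\<dots> = edge_avg n (\<lambda>e. if both_isolated G e then h (insert e G) else 0)
      + (?N * ?a - ?N * edge_avg n (\<lambda>e. of_bool (both_isolated G e)) * ?a) / ?N"
    using N by (simp add: sum.distrib sum_subtractf sum_divide_distrib[symmetric]
        sum_distrib_right[symmetric] edge_avg_def del: sum_of_bool_eq sum_mult_of_bool_eq)
  also have "(?N * ?a - ?N * edge_avg n (\<lambda>e. of_bool (both_isolated G e)) * ?a) / ?N
      = (1 - edge_avg n (\<lambda>e. of_bool (both_isolated G e))) * ?a"
    using N by (simp add: field_simps)
  finally show ?thesis .
qed

section \<open>Drift and second moment of one round\<close>

text \<open>Merge gains, or their bounds, are built from such symmetric products; their double sums
  reduce to products of two moments.\<close>

lemma sum_symmetrized_product:
  fixes \<alpha> \<beta> :: "'a \<Rightarrow> real"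
  shows "(\<Sum>v\<in>A. \<Sum>w\<in>A. \<alpha> v * \<beta> w + \<beta> v * \<alpha> w) = 2 * sum \<alpha> A * sum \<beta> A"
  unfolding sum.distrib sum_product[symmetric] by simp

text \<open>\<open>\<psi>\<close> will be the identity for the drift and the square for the second
  moment. Because \<open>\<psi> 0 = 0\<close>, pairs in a common component contribute nothing, so
  the diagonal can be included and the sum runs over all pairs.\<close>

lemma edge_avg_comp_sum_change:
  assumes G: "G \<subseteq> all_edges n" and \<psi>: "\<psi> 0 = 0"
  shows "edge_avg n (\<lambda>e. \<psi> (comp_sum f n (insert e G) - comp_sum f n G)) =
    (\<Sum>v<n. \<Sum>w<n. if component G v = component G w then 0
       else \<psi> (merge_gain f (card (component G v)) (card (component G w)))) / (real n * (real n - 1))"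
proof -
  have "(\<Sum>w\<in>{..<n} - {v}. \<psi> (comp_sum f n (insert {v, w} G) - comp_sum f n G)) =
    (\<Sum>w<n. if component G v = component G w then 0
       else \<psi> (merge_gain f (card (component G v)) (card (component G w))))" if "v < n" for v
    using G that \<psi> by (intro sum.mono_neutral_cong_left) (auto simp: comp_sum_insert)
  then show ?thesis by (simp add: edge_avg_pairs)
qed

text \<open>These assumptions isolate what a bound on \<open>s_4\<close> provides:
  \<open>third\<close> is that bound read as a vertex moment, and \<open>size_le\<close> caps the
  components by an \<open>L\<close> that will be of order n^(1/4).\<close>

context
  fixes n :: nat and G :: "nat set set" and f :: "nat \<Rightarrow> real" and B L :: real
  assumes n: "2 \<le> n" and G: "G \<subseteq> all_edges n"
    and growth: "\<And>a b. 1 \<le> a \<Longrightarrow> 1 \<le> b \<Longrightarrow>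
      \<bar>merge_gain f a b\<bar> \<le> 7 * (real a ^ 3 * real b + real a * real b ^ 3)"
    and B: "1 \<le> B" and L: "1 \<le> L"
    and third: "(\<Sum>v<n. real (card (component G v)) ^ 3) \<le> real n * B"
    and size_le: "\<And>v. v < n \<Longrightarrow> real (card (component G v)) \<le> L"
begin

abbreviation (input) "sz v \<equiv> real (card (component G v))"
abbreviation (input) "gain v w \<equiv> merge_gain f (card (component G v)) (card (component G w))"

lemma size_ge_1: "v < n \<Longrightarrow> 1 \<le> sz v"
  using card_component_pos[OF G, of v] by simp

lemma gain_bound:
  "v < n \<Longrightarrow> w < n \<Longrightarrow> \<bar>gain v w\<bar> \<le> 7 * (sz v ^ 3 * sz w + sz v * sz w ^ 3)"
  using size_ge_1[of v] size_ge_1[of w] by (intro growth) auto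

lemma low_moment: "k \<le> 3 \<Longrightarrow> (\<Sum>v<n. sz v ^ k) \<le> real n * B"
  by (rule order_trans[OF _ third]) (auto intro!: sum_mono power_increasing dest: size_ge_1)

text \<open>Each power beyond the third costs one factor \<open>L\<close>. The drift error needs the
  fifth moment and the second moment of a jump needs the sixth, whence the factors
  \<open>L^2\<close> and \<open>L^3\<close> below.\<close>

lemma high_moment: "(\<Sum>v<n. sz v ^ (k + 3)) \<le> L ^ k * (real n * B)"
proof -
  have "(\<Sum>v<n. sz v ^ (k + 3)) \<le> (\<Sum>v<n. L ^ k * sz v ^ 3)"
    unfolding power_add using size_le by (intro sum_mono mult_right_mono power_mono) auto
  also have "\<dots> \<le> L ^ k * (real n * B)"
    unfolding sum_distrib_left[symmetric] using third L by (intro mult_left_mono) auto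
  finally show ?thesis .
qed

lemma mean_gain_bound: "\<bar>(\<Sum>v<n. \<Sum>w<n. gain v w) / (real n)\<^sup>2\<bar> \<le> 14 * B\<^sup>2"
proof -
  have "\<bar>\<Sum>v<n. \<Sum>w<n. gain v w\<bar> \<le> (\<Sum>v<n. \<Sum>w<n. \<bar>gain v w\<bar>)"
    by (intro order_trans[OF sum_abs] sum_mono sum_abs)
  also have "\<dots> \<le> (\<Sum>v<n. \<Sum>w<n. 7 * (sz v ^ 3 * sz w + sz v * sz w ^ 3))"
    by (intro sum_mono gain_bound) auto
  also have "\<dots> = 14 * ((\<Sum>v<n. sz v ^ 3) * (\<Sum>v<n. sz v ^ 1))"
    unfolding sum_distrib_left[symmetric] sum_symmetrized_product by simp
  also have "\<dots> \<le> 14 * ((real n * B) * (real n * B))"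
    using third low_moment[of 1] B by (intro mult_left_mono mult_mono sum_nonneg) auto
  finally have "\<bar>\<Sum>v<n. \<Sum>w<n. gain v w\<bar> \<le> 14 * B\<^sup>2 * (real n)\<^sup>2"
    by (simp add: power2_eq_square mult_ac)
  then show ?thesis using n by (simp add: abs_divide pos_divide_le_eq)
qed

text \<open>Two corrections separate the edge average from the mean-field double sum: the pairs
  inside a common component, collected in \<open>S\<close>, and the normalisation by n(n - 1)
  instead of n^2.\<close>

lemma edge_avg_change:
  "\<bar>edge_avg n (\<lambda>e. comp_sum f n (insert e G) - comp_sum f n G)
    - (\<Sum>v<n. \<Sum>w<n. gain v w) / (real n)\<^sup>2\<bar> \<le> 56 * B\<^sup>2 * L\<^sup>2 / real n"
proof -
  define T where "T = (\<Sum>v<n. \<Sum>w<n. gain v w)"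
  define S where "S = (\<Sum>v<n. \<Sum>w<n. if component G v = component G w then gain v w else 0)"
  let ?N = "real n"
  have N: "2 \<le> ?N" using n by simp
  have "edge_avg n (\<lambda>e. comp_sum f n (insert e G) - comp_sum f n G)
      = (\<Sum>v<n. \<Sum>w<n. if component G v = component G w then 0 else gain v w) / (?N * (?N - 1))"
    using edge_avg_comp_sum_change[OF G, of "\<lambda>x. x" f] by simp
  also have "(\<Sum>v<n. \<Sum>w<n. if component G v = component G w then 0 else gain v w) = T - S"
    unfolding T_def S_def sum_subtractf[symmetric] by (intro sum.cong) auto
  finally have avg: "edge_avg n (\<lambda>e. comp_sum f n (insert e G) - comp_sum f n G) = (T - S) / (?N * (?N - 1))" .
  have "\<bar>S\<bar> \<le> (\<Sum>v<n. \<Sum>w<n. \<bar>if component G v = component G w then gain v w else 0\<bar>)"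
    unfolding S_def by (intro order_trans[OF sum_abs] sum_mono sum_abs)
  \<comment> \<open>Inside a component both sizes agree, so a gain is at most 14 times the fourth
    power of the size; summing over the vertices of the component raises this to the fifth
    power.\<close>
  also have "\<dots> \<le> (\<Sum>v<n. \<Sum>w<n. if w \<in> component G v then 14 * sz v ^ 4 else 0)"
  proof (intro sum_mono)
    fix v w assume "v \<in> {..<n}" "w \<in> {..<n}"
    then show "\<bar>if component G v = component G w then gain v w else 0\<bar>
        \<le> (if w \<in> component G v then 14 * sz v ^ 4 else 0)"
      using gain_bound[of v v] gain_bound[of v w] component_eq_iff[of G v w]
      by (auto simp: power_numeral_reduce algebra_simps)
  qed
  also have "\<dots> = (\<Sum>v<n. 14 * sz v ^ (2 + 3))"
  proof (intro sum.cong refl)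
    fix v assume "v \<in> {..<n}"
    then have "{..<n} \<inter> component G v = component G v" using component_subset[OF G] by auto
    then show "(\<Sum>w<n. if w \<in> component G v then 14 * sz v ^ 4 else 0) = 14 * sz v ^ (2 + 3)"
      by (simp add: sum.inter_restrict[symmetric] power_numeral_reduce)
  qed
  also have "\<dots> \<le> 14 * (L\<^sup>2 * (?N * B))"
    unfolding sum_distrib_left[symmetric] using high_moment[of 2] by (intro mult_left_mono) auto
  finally have S: "\<bar>S / ?N\<bar> \<le> 14 * L\<^sup>2 * B"
    using N by (simp add: abs_divide pos_divide_le_eq mult_ac)
  have T: "\<bar>T / ?N\<^sup>2\<bar> \<le> 14 * B\<^sup>2" unfolding T_def by (rule mean_gain_bound)
  \<comment> \<open>Exact form of both corrections together; the factor 1/(n - 1) is then at most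
    2/n.\<close>
  have "(T - S) / (?N * (?N - 1)) - T / ?N\<^sup>2 = (T / ?N\<^sup>2 - S / ?N) / (?N - 1)"
    using N by (simp add: divide_simps power2_eq_square) (simp add: algebra_simps)
  also have "\<bar>\<dots>\<bar> \<le> (14 * B\<^sup>2 + 14 * L\<^sup>2 * B) / (?N - 1)"
  proof -
    have "\<bar>T / ?N\<^sup>2 - S / ?N\<bar> \<le> 14 * B\<^sup>2 + 14 * L\<^sup>2 * B" using S T by linarith
    then show ?thesis unfolding abs_divide using N by (simp add: divide_right_mono)
  qed
  also have "\<dots> \<le> (28 * B\<^sup>2 * L\<^sup>2) / (?N / 2)"
  proof (intro frac_le)
    have "1 * B\<^sup>2 \<le> L\<^sup>2 * B\<^sup>2" using L by (intro mult_right_mono) auto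
    moreover have "L\<^sup>2 * B \<le> L\<^sup>2 * B\<^sup>2" using B by (intro mult_left_mono) (auto simp: power2_eq_square)
    ultimately show "14 * B\<^sup>2 + 14 * L\<^sup>2 * B \<le> 28 * B\<^sup>2 * L\<^sup>2" by (simp add: mult_ac)
  qed (use N in auto)
  finally show ?thesis unfolding avg T_def[symmetric] by simp
qed

text \<open>Squaring the gain bound and splitting the square of the sum leaves a sixth moment times
  a second moment. The constant is 49 from the bound, times 2 for the splitting, times 2 for
  symmetry, times 2 for n/(n - 1).\<close>

lemma edge_avg_change_squared:
  "edge_avg n (\<lambda>e. (comp_sum f n (insert e G) - comp_sum f n G)\<^sup>2) \<le> 392 * B\<^sup>2 * L ^ 3"
proof -
  let ?N = "real n"
  have N: "2 \<le> ?N" using n by simp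
  have "(\<Sum>v<n. \<Sum>w<n. if component G v = component G w then 0 else (gain v w)\<^sup>2)
      \<le> (\<Sum>v<n. \<Sum>w<n. 98 * (sz v ^ (3 + 3) * (sz w)\<^sup>2 + (sz v)\<^sup>2 * sz w ^ (3 + 3)))"
  proof (intro sum_mono)
    fix v w assume "v \<in> {..<n}" "w \<in> {..<n}"
    then have "(gain v w)\<^sup>2 \<le> (7 * (sz v ^ 3 * sz w + sz v * sz w ^ 3))\<^sup>2"
      using gain_bound[of v w] by (intro power2_le_iff_abs_le[THEN iffD2]) auto
    also have "\<dots> = 49 * (sz v ^ 3 * sz w + sz v * sz w ^ 3)\<^sup>2"
      by (subst power_mult_distrib) simp
    also have "\<dots> \<le> 49 * (2 * ((sz v ^ 3 * sz w)\<^sup>2 + (sz v * sz w ^ 3)\<^sup>2))"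
    proof (rule mult_left_mono)
      have "0 \<le> (sz v ^ 3 * sz w - sz v * sz w ^ 3)\<^sup>2" by simp
      then show "(sz v ^ 3 * sz w + sz v * sz w ^ 3)\<^sup>2
          \<le> 2 * ((sz v ^ 3 * sz w)\<^sup>2 + (sz v * sz w ^ 3)\<^sup>2)"
        unfolding power2_sum power2_diff by simp
    qed simp
    also have "\<dots> = 98 * (sz v ^ (3 + 3) * (sz w)\<^sup>2 + (sz v)\<^sup>2 * sz w ^ (3 + 3))"
      by (simp add: power_mult_distrib flip: power_mult)
    finally show "(if component G v = component G w then 0 else (gain v w)\<^sup>2)
        \<le> 98 * (sz v ^ (3 + 3) * (sz w)\<^sup>2 + (sz v)\<^sup>2 * sz w ^ (3 + 3))"
      by (auto intro: add_nonneg_nonneg)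
  qed
  also have "\<dots> = 196 * ((\<Sum>v<n. sz v ^ (3 + 3)) * (\<Sum>v<n. (sz v)\<^sup>2))"
    unfolding sum_distrib_left[symmetric] sum_symmetrized_product by simp
  also have "\<dots> \<le> 196 * ((L ^ 3 * (?N * B)) * (?N * B))"
    using high_moment[of 3] low_moment[of 2] B L by (intro mult_left_mono mult_mono sum_nonneg) auto
  finally have "edge_avg n (\<lambda>e. (comp_sum f n (insert e G) - comp_sum f n G)\<^sup>2)
      \<le> 196 * ((L ^ 3 * (?N * B)) * (?N * B)) / (?N * (?N - 1))"
    unfolding edge_avg_comp_sum_change[OF G, of "\<lambda>x. x\<^sup>2" f, OF zero_power2]
    using N by (intro divide_right_mono) auto
  also have "\<dots> = (196 * B\<^sup>2 * L ^ 3) * (?N / (?N - 1))"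
    using N by (simp add: field_simps power2_eq_square)
  also have "\<dots> \<le> (196 * B\<^sup>2 * L ^ 3) * 2"
    using N L by (intro mult_left_mono) (auto simp: field_simps)
  finally show ?thesis by simp
qed

text \<open>\<open>I * (I - 1)\<close> counts the ordered pairs of distinct isolated
  vertices.\<close>

lemma edge_avg_both_isolated:
  assumes I: "I = comp_sum (\<lambda>a. of_bool (a = 1)) n G"
  shows "edge_avg n (\<lambda>e. of_bool (both_isolated G e)) = I * (I - 1) / (real n * (real n - 1))"
    and "0 \<le> I" "I \<le> real n"
proof -
  let ?o = "\<lambda>v. of_bool (card (component G v) = 1) :: real"
  \<comment> \<open>At size one, counting components and counting vertices agree, which allows
    passing to a sum over vertices.\<close>
  have "I = comp_sum (\<lambda>a. real a * of_bool (a = 1)) n G"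
    unfolding I comp_sum_def by (intro sum.cong) auto
  then have I': "I = (\<Sum>v<n. ?o v)" unfolding sum_vertices[OF G, symmetric] by simp
  show "0 \<le> I" unfolding I' by (intro sum_nonneg) auto
  have "I \<le> (\<Sum>v<n. 1)" unfolding I' by (intro sum_mono) auto
  then show "I \<le> real n" by simp
  have "(\<Sum>v<n. \<Sum>w\<in>{..<n} - {v}. of_bool (both_isolated G {v, w})) = (\<Sum>v<n. ?o v * (I - ?o v))"
  proof (intro sum.cong refl)
    fix v assume v: "v \<in> {..<n}"
    have "(\<Sum>w\<in>{..<n} - {v}. of_bool (both_isolated G {v, w})) = (\<Sum>w\<in>{..<n} - {v}. ?o v * ?o w)"
      using v by (intro sum.cong) (auto simp: both_isolated_def isolated_iff_card_component[OF G])
    also have "\<dots> = ?o v * (I - ?o v)"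
      unfolding I' sum_distrib_left[symmetric] using v by (subst sum_diff1) auto
    finally show "(\<Sum>w\<in>{..<n} - {v}. of_bool (both_isolated G {v, w})) = ?o v * (I - ?o v)" .
  qed
  also have "\<dots> = (\<Sum>v<n. ?o v * (I - 1))" by (intro sum.cong) auto
  also have "\<dots> = I * (I - 1)" unfolding sum_distrib_right[symmetric] I'[symmetric] ..
  finally show "edge_avg n (\<lambda>e. of_bool (both_isolated G e)) = I * (I - 1) / (real n * (real n - 1))"
    by (simp add: edge_avg_pairs)
qed

lemma change_both_isolated:
  assumes "e \<in> all_edges n" "both_isolated G e"
  shows "comp_sum f n (insert e G) - comp_sum f n G = merge_gain f 1 1"
proof -
  obtain v w where e: "v < n" "w < n" "v \<noteq> w" "e = {v, w}" using assms by (auto simp: all_edges_def)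
  then have c: "card (component G v) = 1" "card (component G w) = 1"
    using assms isolated_iff_card_component[OF G] by (auto simp: both_isolated_def)
  then have "component G v \<noteq> component G w"
    using e self_in_component[of v G] self_in_component[of w G] by (metis card_1_singletonE singletonD)
  then show ?thesis using c e comp_sum_insert[OF G] by simp
qed

text \<open>The exact mean is \<open>p * ?q + (1 - p) * A\<close>, with \<open>p\<close> the
  acceptance probability and \<open>A\<close> the plain edge average. Replacing \<open>p\<close> by
  \<open>x^2\<close> and \<open>A\<close> by \<open>T\<close> costs O(1/n) times \<open>B^2\<close>
  and \<open>B^2 L^2\<close> respectively.\<close>

lemma bf_step_drift:
  fixes x T :: real
  defines "x \<equiv> comp_sum (\<lambda>a. of_bool (a = 1)) n G / real n"
    and "T \<equiv> (\<Sum>v<n. \<Sum>w<n. gain v w) / (real n)\<^sup>2"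
  shows "\<bar>measure_pmf.expectation (bf_step n G) (\<lambda>H. comp_sum f n H - comp_sum f n G)
    - (x\<^sup>2 * merge_gain f 1 1 + (1 - x\<^sup>2) * T)\<bar> \<le> 112 * B\<^sup>2 * L\<^sup>2 / real n"
proof -
  define p where "p = edge_avg n (\<lambda>e. of_bool (both_isolated G e))"
  define A where "A = edge_avg n (\<lambda>e. comp_sum f n (insert e G) - comp_sum f n G)"
  define I where "I = comp_sum (\<lambda>a. of_bool (a = 1)) n G"
  let ?N = "real n" and ?q = "merge_gain f 1 1"
  have N: "2 \<le> ?N" using n by simp
  note I = edge_avg_both_isolated[OF I_def, folded p_def]
  have iso: "edge_avg n (\<lambda>e. if both_isolated G e then comp_sum f n (insert e G) - comp_sum f n G else 0)
      = p * ?q"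
    unfolding p_def edge_avg_def times_divide_eq_left sum_distrib_right
    by (intro arg_cong2[where f = "(/)"] sum.cong refl) (simp add: change_both_isolated)
  have E: "measure_pmf.expectation (bf_step n G) (\<lambda>H. comp_sum f n H - comp_sum f n G)
      = p * ?q + (1 - p) * A"
    unfolding expectation_bf_step[OF n] iso p_def[symmetric] A_def[symmetric] ..
  have p01: "0 \<le> p" "p \<le> 1"
  proof -
    show "0 \<le> p" unfolding p_def by (rule edge_avg_nonneg) simp
    have "p \<le> edge_avg n (\<lambda>_. 1)" unfolding p_def by (rule edge_avg_mono) simp
    then show "p \<le> 1" using all_edges_nonempty[OF n] by (simp add: edge_avg_def finite_all_edges)
  qed
  have p: "\<bar>p - x\<^sup>2\<bar> \<le> 2 / ?N"
  proof -
    \<comment> \<open>The difference between drawing two vertices with and without replacement; it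
      is nonnegative and at most 1/(n - 1).\<close>
    have "x\<^sup>2 - p = (I / ?N) * ((?N - I) / ?N) / (?N - 1)"
      unfolding I(1) x_def I_def[symmetric] using N
      by (simp add: divide_simps power2_eq_square) (simp add: algebra_simps)
    moreover have "(I / ?N) * ((?N - I) / ?N) / (?N - 1) \<le> (1 * 1) / (?N / 2)"
      using I N by (intro frac_le mult_mono) (auto simp: divide_simps)
    moreover have "0 \<le> (I / ?N) * ((?N - I) / ?N) / (?N - 1)" using I N by simp
    ultimately show ?thesis by simp
  qed
  have q: "\<bar>?q\<bar> \<le> 14" using growth[of 1 1] by simp
  have T: "\<bar>T\<bar> \<le> 14 * B\<^sup>2" unfolding T_def by (rule mean_gain_bound)
  have A: "\<bar>A - T\<bar> \<le> 56 * B\<^sup>2 * L\<^sup>2 / ?N" unfolding A_def T_def by (rule edge_avg_change)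
  have "p * ?q + (1 - p) * A - (x\<^sup>2 * ?q + (1 - x\<^sup>2) * T)
      = (p - x\<^sup>2) * ?q + (1 - p) * (A - T) - (p - x\<^sup>2) * T"
    by (simp add: algebra_simps)
  also have "\<bar>\<dots>\<bar> \<le> \<bar>(p - x\<^sup>2) * ?q\<bar> + \<bar>(1 - p) * (A - T)\<bar> + \<bar>(p - x\<^sup>2) * T\<bar>" by linarith
  also have "\<dots> \<le> 2 / ?N * 14 + 1 * (56 * B\<^sup>2 * L\<^sup>2 / ?N) + 2 / ?N * (14 * B\<^sup>2)"
    unfolding abs_mult using p p01 q T A by (intro add_mono mult_mono) auto
  also have "\<dots> = (28 + 56 * (B\<^sup>2 * L\<^sup>2) + 28 * B\<^sup>2) / ?N" by (simp add: add_divide_distrib)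
  also have "\<dots> \<le> 112 * B\<^sup>2 * L\<^sup>2 / ?N"
  proof (intro divide_right_mono)
    have "1 \<le> B\<^sup>2" "B\<^sup>2 * 1 \<le> B\<^sup>2 * L\<^sup>2" using B L by (auto intro!: mult_left_mono)
    then show "28 + 56 * (B\<^sup>2 * L\<^sup>2) + 28 * B\<^sup>2 \<le> 112 * B\<^sup>2 * L\<^sup>2" by linarith
  qed simp
  finally show ?thesis unfolding E .
qed

text \<open>By nonnegativity, the accepted and the rejected case are each bounded by the full edge
  average of the squared change.\<close>

lemma bf_step_jump:
  "measure_pmf.expectation (bf_step n G) (\<lambda>H. (comp_sum f n H - comp_sum f n G)\<^sup>2) \<le> 784 * B\<^sup>2 * L ^ 3"
proof -
  let ?h = "\<lambda>e. (comp_sum f n (insert e G) - comp_sum f n G)\<^sup>2"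
  let ?p = "edge_avg n (\<lambda>e. of_bool (both_isolated G e))"
  have "edge_avg n (\<lambda>e. if both_isolated G e then ?h e else 0) \<le> edge_avg n ?h"
    by (rule edge_avg_mono) simp
  moreover have "(1 - ?p) * edge_avg n ?h \<le> 1 * edge_avg n ?h"
    by (intro mult_right_mono) (auto intro: edge_avg_nonneg)
  ultimately show ?thesis using edge_avg_change_squared by (simp add: expectation_bf_step[OF n])
qed

end

section \<open>The limiting differential equations\<close>

text \<open>The bound \<open>C\<close> accompanies the Lipschitz constant because products of
  Lipschitz functions are Lipschitz only as long as the factors are bounded; the pair is closed
  under all polynomial operations.\<close>

definition bounded_lipschitz :: "'j set \<Rightarrow> real \<Rightarrow> (('j \<Rightarrow> real) \<Rightarrow> real) \<Rightarrow> bool" where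
  "bounded_lipschitz J M g \<longleftrightarrow> (\<exists>K C. \<forall>z z'.
     (\<forall>i\<in>J. \<bar>z i\<bar> \<le> M) \<longrightarrow> (\<forall>i\<in>J. \<bar>z' i\<bar> \<le> M) \<longrightarrow>
     \<bar>g z\<bar> \<le> C \<and> \<bar>g z - g z'\<bar> \<le> K * (\<Sum>i\<in>J. \<bar>z i - z' i\<bar>))"

lemma bounded_lipschitz_const: "bounded_lipschitz J M (\<lambda>_. c)"
  unfolding bounded_lipschitz_def by (rule exI[of _ 0], rule exI[of _ "\<bar>c\<bar>"]) simp

lemma bounded_lipschitz_proj:
  assumes "finite J" "i \<in> J"
  shows "bounded_lipschitz J M (\<lambda>z. z i)"
proof -
  have "\<bar>z i - z' i\<bar> \<le> 1 * (\<Sum>i\<in>J. \<bar>z i - z' i\<bar>)" for z z' :: "'a \<Rightarrow> real"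
    using assms member_le_sum[of i J "\<lambda>i. \<bar>z i - z' i\<bar>"] by simp
  then show ?thesis unfolding bounded_lipschitz_def using assms by blast
qed

lemma bounded_lipschitz_add:
  assumes "bounded_lipschitz J M g" "bounded_lipschitz J M h"
  shows "bounded_lipschitz J M (\<lambda>z. g z + h z)"
proof -
  let ?box = "\<lambda>z. \<forall>i\<in>J. \<bar>z i\<bar> \<le> M" and ?s = "\<lambda>z z'. \<Sum>i\<in>J. \<bar>z i - z' i\<bar>"
  obtain K C where g: "\<And>z z'. ?box z \<Longrightarrow> ?box z' \<Longrightarrow> \<bar>g z\<bar> \<le> C \<and> \<bar>g z - g z'\<bar> \<le> K * ?s z z'"
    using assms(1) unfolding bounded_lipschitz_def by blast
  obtain K' C' where h: "\<And>z z'. ?box z \<Longrightarrow> ?box z' \<Longrightarrow> \<bar>h z\<bar> \<le> C' \<and> \<bar>h z - h z'\<bar> \<le> K' * ?s z z'"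
    using assms(2) unfolding bounded_lipschitz_def by blast
  have "\<bar>g z + h z\<bar> \<le> C + C' \<and> \<bar>(g z + h z) - (g z' + h z')\<bar> \<le> (K + K') * ?s z z'"
    if "?box z" "?box z'" for z z'
    using g[OF that] h[OF that] unfolding distrib_right by linarith
  then show ?thesis unfolding bounded_lipschitz_def by blast
qed

lemma bounded_lipschitz_mult:
  assumes "bounded_lipschitz J M g" "bounded_lipschitz J M h"
  shows "bounded_lipschitz J M (\<lambda>z. g z * h z)"
proof -
  let ?box = "\<lambda>z. \<forall>i\<in>J. \<bar>z i\<bar> \<le> M" and ?s = "\<lambda>z z'. \<Sum>i\<in>J. \<bar>z i - z' i\<bar>"
  obtain K C where g: "\<And>z z'. ?box z \<Longrightarrow> ?box z' \<Longrightarrow> \<bar>g z\<bar> \<le> C \<and> \<bar>g z - g z'\<bar> \<le> K * ?s z z'"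
    using assms(1) unfolding bounded_lipschitz_def by blast
  obtain K' C' where h: "\<And>z z'. ?box z \<Longrightarrow> ?box z' \<Longrightarrow> \<bar>h z\<bar> \<le> C' \<and> \<bar>h z - h z'\<bar> \<le> K' * ?s z z'"
    using assms(2) unfolding bounded_lipschitz_def by blast
  have "\<bar>g z * h z\<bar> \<le> C * C' \<and> \<bar>g z * h z - g z' * h z'\<bar> \<le> (C * K' + C' * K) * ?s z z'"
    if z: "?box z" "?box z'" for z z'
  proof
    show "\<bar>g z * h z\<bar> \<le> C * C'"
      unfolding abs_mult using g[OF z] h[OF z] by (intro mult_mono) auto
    have "g z * h z - g z' * h z' = g z * (h z - h z') + (g z - g z') * h z'"
      by (simp add: algebra_simps)
    also have "\<bar>\<dots>\<bar> \<le> \<bar>g z\<bar> * \<bar>h z - h z'\<bar> + \<bar>g z - g z'\<bar> * \<bar>h z'\<bar>"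
      unfolding abs_mult[symmetric] by (rule abs_triangle_ineq)
    also have "\<dots> \<le> C * (K' * ?s z z') + (K * ?s z z') * C'"
      using g[OF z] h[OF z] h[OF z(2,1)] by (intro add_mono mult_mono) auto
    finally show "\<bar>g z * h z - g z' * h z'\<bar> \<le> (C * K' + C' * K) * ?s z z'"
      by (simp add: algebra_simps)
  qed
  then show ?thesis unfolding bounded_lipschitz_def by blast
qed

lemma bounded_lipschitz_diff:
  assumes "bounded_lipschitz J M g" "bounded_lipschitz J M h"
  shows "bounded_lipschitz J M (\<lambda>z. g z - h z)"
  using bounded_lipschitz_add[OF assms(1) bounded_lipschitz_mult[OF bounded_lipschitz_const[of _ _ "-1"] assms(2)]]
  by simp

section \<open>The four statistics: initial values, merge gains and mean drift\<close>

lemma comp_sum_empty: "comp_sum f n {} = real n * f 1"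
proof -
  have "component {} v = {v}" for v by (auto simp: component_def adj_def)
  then have "components n {} = (\<lambda>v. {v}) ` {..<n}" by (simp add: components_def)
  then show ?thesis by (simp add: comp_sum_def sum.reindex)
qed

text \<open>Index 1 stands for the fraction of isolated vertices, i.e. of components of size one.\<close>

definition bf_stat :: "nat \<Rightarrow> nat \<Rightarrow> real" where
  "bf_stat j a = (if j = 1 then of_bool (a = 1) else real a ^ j)"

definition bf_rhs :: "nat \<Rightarrow> (nat \<Rightarrow> real) \<Rightarrow> real" where
  "bf_rhs j z =
    (if j = 1 then - ((z 1)\<^sup>2) - (1 - (z 1)\<^sup>2) * z 1
     else if j = 2 then (z 1)\<^sup>2 + (1 - (z 1)\<^sup>2) * (z 2)\<^sup>2
     else if j = 3 then 3 * (z 1)\<^sup>2 + 3 * (1 - (z 1)\<^sup>2) * z 2 * z 3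
     else 7 * (z 1)\<^sup>2 + (1 - (z 1)\<^sup>2) * (4 * z 2 * z 4 + 3 * (z 3)\<^sup>2))"

lemma bounded_lipschitz_bf_rhs: "bounded_lipschitz {1, 2, 3, 4} M (bf_rhs j)"
proof -
  note rules = bounded_lipschitz_const bounded_lipschitz_proj bounded_lipschitz_add
    bounded_lipschitz_diff bounded_lipschitz_mult
  \<comment> \<open>Squares are written as products and the leading minus as a difference from 0, to
    match the closure rules.\<close>
  have "bounded_lipschitz {1, 2, 3, 4} M (\<lambda>z. 0 - z 1 * z 1 - (1 - z 1 * z 1) * z (1::nat))"
    by (intro rules) auto
  moreover have "bounded_lipschitz {1, 2, 3, 4} M (\<lambda>z. z 1 * z 1 + (1 - z 1 * z 1) * (z 2 * z (2::nat)))"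
    by (intro rules) auto
  moreover have "bounded_lipschitz {1, 2, 3, 4} M
      (\<lambda>z. 3 * (z 1 * z 1) + 3 * (1 - z 1 * z 1) * z 2 * z (3::nat))"
    by (intro rules) auto
  moreover have "bounded_lipschitz {1, 2, 3, 4} M
      (\<lambda>z. 7 * (z 1 * z 1) + (1 - z 1 * z 1) * (4 * z 2 * z 4 + 3 * (z 3 * z (3::nat))))"
    by (intro rules) auto
  ultimately show ?thesis unfolding bf_rhs_def power2_eq_square
    by (cases "j = 1"; cases "j = 2"; cases "j = 3"; simp)
qed

text \<open>Binomial expansion for the powers. For index 1, positive sizes ensure that the merged
  component has size at least two and is never counted as isolated.\<close>

lemma merge_gain_bf_stat:
  assumes "1 \<le> a" "1 \<le> b"
  shows "merge_gain (bf_stat 1) a b = - of_bool (a = 1) - of_bool (b = 1)"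
    and "merge_gain (bf_stat 2) a b = 2 * (real a * real b)"
    and "merge_gain (bf_stat 3) a b = 3 * ((real a)\<^sup>2 * real b + real a * (real b)\<^sup>2)"
    and "merge_gain (bf_stat 4) a b
      = 4 * (real a ^ 3 * real b + real a * real b ^ 3) + 6 * ((real a)\<^sup>2 * (real b)\<^sup>2)"
  using assms by (auto simp: merge_gain_def bf_stat_def power_numeral_reduce algebra_simps)

text \<open>Index 4 determines the constant: \<open>a b (a - b)^2 \<ge> 0\<close> bounds the middle
  term \<open>6 a^2 b^2\<close> by three times \<open>a^3 b + a b^3\<close>, and 4 + 3 = 7. The
  other gains have lower degree and are dominated because sizes are at least one.\<close>

lemma bf_stat_growth:
  assumes "j \<in> {1, 2, 3, 4}" "1 \<le> a" "1 \<le> b"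
  shows "\<bar>merge_gain (bf_stat j) a b\<bar> \<le> 7 * (real a ^ 3 * real b + real a * real b ^ 3)"
proof -
  define x y where "x = real a" and "y = real b"
  have ab: "1 \<le> x" "1 \<le> y" using assms by (auto simp: x_def y_def)
  have pw: "x ^ k * y ^ l \<le> x ^ k' * y ^ l'" if "k \<le> k'" "l \<le> l'" for k l k' l'
    using that ab by (intro mult_mono power_increasing) auto
  have 1: "1 \<le> x ^ 3 * y" "1 \<le> x * y ^ 3"
    using pw[of 0 3 0 1] pw[of 0 1 0 3] by auto
  have 2: "x * y \<le> x ^ 3 * y" using pw[of 1 3 1 1] by simp
  have 3: "x\<^sup>2 * y \<le> x ^ 3 * y" "x * y\<^sup>2 \<le> x * y ^ 3" using pw[of 2 3 1 1] pw[of 1 1 2 3] by auto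
  have "0 \<le> x * y * (x - y)\<^sup>2" using ab by simp
  then have 4: "2 * (x\<^sup>2 * y\<^sup>2) \<le> x ^ 3 * y + x * y ^ 3"
    by (simp add: power_numeral_reduce algebra_simps)
  have nn: "0 \<le> x * y" "0 \<le> x\<^sup>2 * y" "0 \<le> x * y\<^sup>2" "0 \<le> x\<^sup>2 * y\<^sup>2" using ab by auto
  note gain = merge_gain_bf_stat[OF assms(2,3), folded x_def y_def]
  have bound: "\<bar>h\<bar> \<le> 7 * (x ^ 3 * y + x * y ^ 3)"
    if "\<bar>h\<bar> \<le> c" "c \<le> 7 * P" "P = x ^ 3 * y + x * y ^ 3" for h c P :: real
    using that by simp
  obtain P where P: "P = x ^ 3 * y + x * y ^ 3" by simp
  have "\<bar>merge_gain (bf_stat 1) a b\<bar> \<le> 2" unfolding gain by simp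
  moreover have "2 \<le> 7 * P" using add_mono[OF 1] by (simp add: P)
  ultimately have "\<bar>merge_gain (bf_stat 1) a b\<bar> \<le> 7 * (x ^ 3 * y + x * y ^ 3)"
    using P by (rule bound)
  moreover have "\<bar>merge_gain (bf_stat 2) a b\<bar> \<le> 7 * (x ^ 3 * y + x * y ^ 3)"
  proof (rule bound[OF _ _ P])
    show "\<bar>merge_gain (bf_stat 2) a b\<bar> \<le> 2 * (x * y)" unfolding gain using nn by simp
    have "x * y + 0 \<le> P" unfolding P using 1 2 by (intro add_mono) auto
    then show "2 * (x * y) \<le> 7 * P" using nn by simp
  qed
  moreover have "\<bar>merge_gain (bf_stat 3) a b\<bar> \<le> 7 * (x ^ 3 * y + x * y ^ 3)"
  proof (rule bound[OF _ _ P])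
    have nn': "0 \<le> x\<^sup>2 * y + x * y\<^sup>2" using nn by simp
    then show "\<bar>merge_gain (bf_stat 3) a b\<bar> \<le> 3 * (x\<^sup>2 * y + x * y\<^sup>2)" unfolding gain by (simp add: abs_mult)
    have "x\<^sup>2 * y + x * y\<^sup>2 \<le> P" unfolding P using 3 by (intro add_mono)
    then show "3 * (x\<^sup>2 * y + x * y\<^sup>2) \<le> 7 * P" using nn' by simp
  qed
  moreover have "\<bar>merge_gain (bf_stat 4) a b\<bar> \<le> 7 * (x ^ 3 * y + x * y ^ 3)"
  proof (rule bound[OF _ _ P])
    have "0 \<le> P" unfolding P using ab by simp
    then show "\<bar>merge_gain (bf_stat 4) a b\<bar> \<le> 4 * P + 3 * (2 * (x\<^sup>2 * y\<^sup>2))"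
      unfolding gain P[symmetric] using nn by simp
    show "4 * P + 3 * (2 * (x\<^sup>2 * y\<^sup>2)) \<le> 7 * P" using 4 by (simp add: P[symmetric])
  qed
  ultimately show ?thesis using assms(1) unfolding x_def y_def by blast
qed

text \<open>Here the process meets the differential equations: once vertex moments are rewritten by
  \<open>sum_vertices\<close>, the mean-field drift is a polynomial in the statistics themselves.
  The factor 2 reflects that a round lasts \<open>2 / n\<close>.\<close>

lemma bf_mean_gain:
  assumes G: "G \<subseteq> all_edges n" and n: "0 < n" and j: "j \<in> {1, 2, 3, 4}"
  defines "z \<equiv> \<lambda>i. comp_sum (bf_stat i) n G / real n"
  shows "(z 1)\<^sup>2 * merge_gain (bf_stat j) 1 1 + (1 - (z 1)\<^sup>2) *
    ((\<Sum>v<n. \<Sum>w<n. merge_gain (bf_stat j) (card (component G v)) (card (component G w))) / (real n)\<^sup>2)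
    = 2 * bf_rhs j z"
proof -
  let ?c = "\<lambda>v. card (component G v)"
  let ?T = "\<lambda>j. \<Sum>v<n. \<Sum>w<n. merge_gain (bf_stat j) (?c v) (?c w)"
  have c1: "1 \<le> ?c v" if "v < n" for v using card_component_pos[OF G that] by simp
  have stat: "comp_sum (bf_stat i) n G = real n * z i" for i using n by (simp add: z_def)
  have s1: "(\<Sum>v<n. of_bool (?c v = 1)) = real n * z 1"
  proof -
    have "(\<Sum>v<n. of_bool (?c v = 1) :: real) = comp_sum (\<lambda>a. real a * of_bool (a = 1)) n G"
      by (rule sum_vertices[OF G])
    also have "\<dots> = comp_sum (bf_stat 1) n G"
      unfolding comp_sum_def by (intro sum.cong) (auto simp: bf_stat_def)
    finally show ?thesis by (simp add: stat)
  qed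
  have sk: "(\<Sum>v<n. real (?c v) ^ k) = real n * z (Suc k)" if "1 \<le> k" for k
  proof -
    have "(\<Sum>v<n. real (?c v) ^ k) = comp_sum (\<lambda>a. real a * real a ^ k) n G"
      by (rule sum_vertices[OF G])
    also have "\<dots> = comp_sum (bf_stat (Suc k)) n G"
      unfolding comp_sum_def using that by (intro sum.cong) (auto simp: bf_stat_def)
    finally show ?thesis by (simp add: stat)
  qed
  have sums: "(\<Sum>v<n. real (?c v)) = real n * z 2" "(\<Sum>v<n. (real (?c v))\<^sup>2) = real n * z 3"
    "(\<Sum>v<n. real (?c v) ^ 3) = real n * z 4"
    using sk[of 1] sk[of 2] sk[of 3] by (simp_all add: numeral_eq_Suc)
  have "?T 1 = (\<Sum>v<n. \<Sum>w<n. - of_bool (?c v = 1) - of_bool (?c w = 1))"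
    by (intro sum.cong refl merge_gain_bf_stat c1) auto
  also have "\<dots> = - 2 * (real n)\<^sup>2 * z 1"
    by (simp add: sum_subtractf sum_negf s1 power2_eq_square sum_distrib_left[symmetric]
        del: sum_of_bool_eq One_nat_def)
  finally have T1: "?T 1 / (real n)\<^sup>2 = - 2 * z 1" using n by simp
  have "?T 2 = (\<Sum>v<n. \<Sum>w<n. 2 * (real (?c v) * real (?c w)))"
    by (intro sum.cong refl merge_gain_bf_stat c1) auto
  also have "\<dots> = 2 * (real n)\<^sup>2 * (z 2)\<^sup>2"
    unfolding sum_distrib_left[symmetric] sum_distrib_right[symmetric] sums by (simp add: power2_eq_square)
  finally have T2: "?T 2 / (real n)\<^sup>2 = 2 * (z 2)\<^sup>2" using n by simp
  have "?T 3 = (\<Sum>v<n. \<Sum>w<n. 3 * ((real (?c v))\<^sup>2 * real (?c w) + real (?c v) * (real (?c w))\<^sup>2))"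
    by (intro sum.cong refl merge_gain_bf_stat c1) auto
  also have "\<dots> = 6 * (real n)\<^sup>2 * (z 2 * z 3)"
    unfolding sum_distrib_left[symmetric] sum_symmetrized_product sums by (simp add: power2_eq_square)
  finally have T3: "?T 3 / (real n)\<^sup>2 = 6 * (z 2 * z 3)" using n by simp
  have "?T 4 = (\<Sum>v<n. \<Sum>w<n. 4 * (real (?c v) ^ 3 * real (?c w) + real (?c v) * real (?c w) ^ 3)
      + 6 * ((real (?c v))\<^sup>2 * (real (?c w))\<^sup>2))"
    by (intro sum.cong refl merge_gain_bf_stat c1) auto
  also have "\<dots> = (real n)\<^sup>2 * (8 * (z 2 * z 4) + 6 * (z 3)\<^sup>2)"
    unfolding sum.distrib
    unfolding sum_distrib_left[symmetric] sum_symmetrized_product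
    unfolding sum_distrib_left[symmetric] sum_distrib_right[symmetric] sums
    by (simp add: power2_eq_square algebra_simps)
  finally have T4: "?T 4 / (real n)\<^sup>2 = 8 * (z 2 * z 4) + 6 * (z 3)\<^sup>2" using n by simp
  have "merge_gain (bf_stat 1) 1 1 = - 2" "merge_gain (bf_stat 2) 1 1 = 2"
    "merge_gain (bf_stat 3) 1 1 = 6" "merge_gain (bf_stat 4) 1 1 = 14"
    by (simp_all add: merge_gain_bf_stat del: One_nat_def)
  then show ?thesis using j
    by (elim insertE emptyE) (simp_all only: T1 T2 T3 T4, simp_all add: bf_rhs_def algebra_simps)
qed

text \<open>With \<open>L\<close> of order n^(1/4), the ratio \<open>L^3 / n\<close> is of order
  n^(-1/4); this governs the second moment of the jumps.\<close>

lemma powr_quarter_cubed_over_n: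
  assumes "0 < b"
  shows "(\<lambda>n. ((real n * b) powr (1/4)) ^ 3 / real n) \<longlonglongrightarrow> 0"
proof -
  have "(\<lambda>n. b powr (3/4) * real n powr (- (1/4))) \<longlonglongrightarrow> b powr (3/4) * 0"
    by (intro tendsto_mult tendsto_const tendsto_neg_powr filterlim_real_sequentially) simp
  moreover have "\<forall>\<^sub>F n in sequentially.
      b powr (3/4) * real n powr (- (1/4)) = ((real n * b) powr (1/4)) ^ 3 / real n"
  proof (rule eventually_mono[OF eventually_gt_at_top[of 0]])
    fix n :: nat assume n: "0 < n"
    have "((real n * b) powr (1/4)) ^ 3 = (real n * b) powr (3/4)"
      using n assms by (simp add: powr_powr flip: powr_realpow)
    also have "\<dots> = real n powr (1 + - (1/4)) * b powr (3/4)" using n assms by (simp add: powr_mult)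
    also have "\<dots> = real n * real n powr (- (1/4)) * b powr (3/4)"
      using n unfolding powr_add by simp
    finally show "b powr (3/4) * real n powr (- (1/4)) = ((real n * b) powr (1/4)) ^ 3 / real n"
      using n by simp
  qed
  ultimately show ?thesis by (simp add: Lim_transform_eventually)
qed

section \<open>Convergence of the susceptibilities before the explosion time\<close>

theorem theorem3p2:
  fixes xb s2 s3 s4 :: "real \<Rightarrow> real" and tc t :: real
  assumes xb0: "xb 0 = 1"
    and xb_ode: "\<And>u. u \<ge> 0 \<Longrightarrow>
        (xb has_real_derivative (- ((xb u)^2) - (1 - (xb u)^2) * xb u)) (at u within {0 ..})"
    and s_init: "s2 0 = 1" "s3 0 = 1" "s4 0 = 1"
    and tc_pos: "0 < tc"
    and s2_ode: "\<And>u. 0 \<le> u \<Longrightarrow> u < tc \<Longrightarrow>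
        (s2 has_real_derivative ((xb u)^2 + (1 - (xb u)^2) * (s2 u)^2)) (at u within {0..<tc})"
    and s3_ode: "\<And>u. 0 \<le> u \<Longrightarrow> u < tc \<Longrightarrow>
        (s3 has_real_derivative (3 * (xb u)^2 + 3 * (1 - (xb u)^2) * s2 u * s3 u)) (at u within {0..<tc})"
    and s4_ode: "\<And>u. 0 \<le> u \<Longrightarrow> u < tc \<Longrightarrow>
        (s4 has_real_derivative (7 * (xb u)^2 + (1 - (xb u)^2) * (4 * s2 u * s4 u + 3 * (s3 u)^2)))
          (at u within {0..<tc})"
    and explode: "filterlim s2 at_top (at_left tc)"
    and t: "0 \<le> t" "t < tc"
  shows "conv_in_prob (BF t) (\<lambda>n. susc 2 n) (s2 t)
       \<and> conv_in_prob (BF t) (\<lambda>n. susc 3 n) (s3 t)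
       \<and> conv_in_prob (BF t) (\<lambda>n. susc 4 n) (s4 t)"
proof -
  define J :: "nat set" where "J = {1, 2, 3, 4}"
  define y where "y j = (if j = 1 then xb else if j = 2 then s2 else if j = 3 then s3 else s4)" for j :: nat
  define Y where "Y j n G = comp_sum (bf_stat j) n G / real n" for j n G
  have ode: "(y j has_real_derivative bf_rhs j (\<lambda>i. y i u)) (at u within {0..t})"
    if "j \<in> J" "0 \<le> u" "u \<le> t" for j u
  proof -
    have sub: "{0..t} \<subseteq> {0..}" "{0..t} \<subseteq> {0..<tc}" "u < tc" using t that by auto
    show ?thesis
      using has_field_derivative_subset[OF xb_ode sub(1)] has_field_derivative_subset[OF s2_ode sub(2)]
        has_field_derivative_subset[OF s3_ode sub(2)] has_field_derivative_subset[OF s4_ode sub(2)]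
        that sub(3)
      by (auto simp: J_def y_def bf_rhs_def)
  qed
  \<comment> \<open>As \<open>t < tc\<close>, the solution is continuous on the compact interval up
    to \<open>t\<close>, which yields the uniform bound \<open>B\<close>.\<close>
  have "compact (y j ` {0..t})" if "j \<in> J" for j
    by (rule compact_continuous_image[OF DERIV_continuous_on[OF ode[OF that]]]) auto
  then have "bounded (\<Union>j\<in>J. y j ` {0..t})"
    by (intro bounded_UN) (auto simp: J_def compact_imp_bounded)
  then obtain B where B: "0 < B" "\<And>j u. j \<in> J \<Longrightarrow> 0 \<le> u \<Longrightarrow> u \<le> t \<Longrightarrow> \<bar>y j u\<bar> \<le> B"
    unfolding bounded_pos by (metis (no_types, lifting) UN_I atLeastAtMost_iff image_eqI real_norm_def)
  obtain K0 where K0: "\<And>j z z'. j \<in> J \<Longrightarrow> \<forall>i\<in>J. \<bar>z i\<bar> \<le> B + 1 \<Longrightarrow> \<forall>i\<in>J. \<bar>z' i\<bar> \<le> B + 1 \<Longrightarrow>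
      \<bar>bf_rhs j z - bf_rhs j z'\<bar> \<le> K0 j * (\<Sum>i\<in>J. \<bar>z i - z' i\<bar>)"
    using bounded_lipschitz_bf_rhs[of "B + 1", folded J_def] unfolding bounded_lipschitz_def by metis
  \<comment> \<open>A single Lipschitz constant for all four equations; the absolute values also
    make it nonnegative.\<close>
  define K where "K = (\<Sum>j\<in>J. \<bar>K0 j\<bar>)"
  have K: "K0 j \<le> K" if "j \<in> J" for j
    using member_le_sum[of j J "\<lambda>j. \<bar>K0 j\<bar>"] that by (simp add: K_def J_def)
  \<comment> \<open>A component of size a contributes a^4 to n times \<open>s_4\<close>, which is at
    most \<open>n * (B + 1)\<close> in the box; hence a is at most \<open>L n\<close>.\<close>
  define L where "L n = (real n * (B + 1)) powr (1/4)" for n :: nat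
  \<comment> \<open>Chosen so that \<open>\<eta> n / n\<close> equals the bound of
    \<open>bf_step_jump\<close> after division by n^2. It also covers the drift error, which has a
    smaller constant and only \<open>L^2\<close>, since \<open>L \<ge> 1\<close>.\<close>
  define \<eta> where "\<eta> n = 784 * (B + 1)\<^sup>2 * (L n ^ 3 / real n)" for n
  have \<eta>: "\<eta> \<longlonglongrightarrow> 0"
    using tendsto_mult[OF tendsto_const[of "784 * (B + 1)\<^sup>2"] powr_quarter_cubed_over_n[of "B + 1"]] B
    unfolding \<eta>_def L_def by simp
  have Y_props: "G \<subseteq> all_edges n" "1 \<le> L n"
      "(\<Sum>v<n. real (card (component G v)) ^ 3) \<le> real n * (B + 1)"
      "\<And>v. v < n \<Longrightarrow> real (card (component G v)) \<le> L n"
    if n: "2 \<le> n" and G: "G \<in> set_pmf (bf n m)" and YB: "\<forall>i\<in>J. \<bar>Y i n G\<bar> \<le> B + 1" for n m G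
  proof -
    show G': "G \<subseteq> all_edges n" using G by (rule set_bf_subset)
    have "1 * 1 \<le> real n * (B + 1)" using n B by (intro mult_mono) auto
    then show "1 \<le> L n" unfolding L_def by (intro ge_one_powr_ge_zero) auto
    have "Y 4 n G \<le> B + 1" using YB by (auto simp: J_def)
    then have s4: "comp_sum (bf_stat 4) n G \<le> real n * (B + 1)"
      using n by (simp add: Y_def pos_divide_le_eq mult.commute)
    have "(\<lambda>a. real a * real a ^ 3) = bf_stat 4"
      by (simp add: fun_eq_iff bf_stat_def power_numeral_reduce)
    then have "(\<Sum>v<n. real (card (component G v)) ^ 3) = comp_sum (bf_stat 4) n G"
      using sum_vertices[OF G', of "\<lambda>a. real a ^ 3"] by simp
    then show "(\<Sum>v<n. real (card (component G v)) ^ 3) \<le> real n * (B + 1)" using s4 by simp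
    fix v assume "v < n"
    then have "real (card (component G v)) ^ 4 \<le> comp_sum (bf_stat 4) n G"
      unfolding comp_sum_def bf_stat_def
      using member_le_sum[of "component G v" "components n G" "\<lambda>C. real (card C) ^ 4"]
      by (auto simp: components_def)
    then have "(real (card (component G v)) ^ 4) powr (1/4) \<le> L n"
      unfolding L_def using s4 by (intro powr_mono2) auto
    moreover have "(real (card (component G v)) ^ 4) powr (1/4) = real (card (component G v))"
    proof -
      have pos: "0 < real (card (component G v))" using card_component_pos[OF G' \<open>v < n\<close>] by simp
      then have "real (card (component G v)) ^ 4 = real (card (component G v)) powr 4"
        by simp
      then show ?thesis using pos by (simp only: powr_powr) simp
    qed
    ultimately show "real (card (component G v)) \<le> L n" by simp
  qed
  have conv: "conv_in_prob (\<lambda>n. bf n (nat \<lfloor>real n * t / 2\<rfloor>)) (Y j) (y j t)" if "j \<in> J" for j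
  proof (rule differential_equation_method[where P = bf and step = bf_step and J = J and F = bf_rhs and \<eta> = \<eta>
        and B = B and K = K and start = "\<lambda>_. {}"])
    show "Y j n {} = y j 0" if "0 < n" "j \<in> J" for n j
      using that xb0 s_init by (auto simp: Y_def comp_sum_empty bf_stat_def J_def y_def)
    show "\<bar>bf_rhs j z - bf_rhs j z'\<bar> \<le> K * (\<Sum>i\<in>J. \<bar>z i - z' i\<bar>)"
      if "j \<in> J" "\<forall>i\<in>J. \<bar>z i\<bar> \<le> B + 1" "\<forall>i\<in>J. \<bar>z' i\<bar> \<le> B + 1" for j z z'
      using K0[OF that] K[OF that(1)]
      by (rule order_trans[OF _ mult_right_mono]) (auto intro: sum_nonneg)
  next
    fix n m G j
    assume n: "2 \<le> n" and G: "G \<in> set_pmf (bf n m)" and j: "j \<in> J"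
      and YB: "\<forall>i\<in>J. \<bar>Y i n G\<bar> \<le> B + 1"
    note props = Y_props[OF n G YB]
    have growth: "\<bar>merge_gain (bf_stat j) a b\<bar> \<le> 7 * (real a ^ 3 * real b + real a * real b ^ 3)"
      if "1 \<le> a" "1 \<le> b" for a b
      using bf_stat_growth j that unfolding J_def by blast
    have B1: "1 \<le> B + 1" and n0: "0 < n" using B n by auto
    let ?E = "measure_pmf.expectation (bf_step n G)"
    have stat1: "bf_stat 1 = (\<lambda>a. of_bool (a = 1))" by (simp add: fun_eq_iff bf_stat_def)
    have dr: "\<bar>?E (\<lambda>H. comp_sum (bf_stat j) n H - comp_sum (bf_stat j) n G) - 2 * bf_rhs j (\<lambda>i. Y i n G)\<bar>
        \<le> 112 * (B + 1)\<^sup>2 * (L n)\<^sup>2 / real n"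
      unfolding Y_def bf_mean_gain[OF props(1) n0 j[unfolded J_def], symmetric] stat1
      by (rule bf_step_drift[OF n props(1) growth B1 props(2,3,4)])
    have EY: "?E (\<lambda>H. Y j n H - Y j n G)
        = ?E (\<lambda>H. comp_sum (bf_stat j) n H - comp_sum (bf_stat j) n G) / real n"
      unfolding Y_def diff_divide_distrib[symmetric] by simp
    have "?E (\<lambda>H. Y j n H - Y j n G) - 2 / real n * bf_rhs j (\<lambda>i. Y i n G) =
        (?E (\<lambda>H. comp_sum (bf_stat j) n H - comp_sum (bf_stat j) n G) - 2 * bf_rhs j (\<lambda>i. Y i n G)) / real n"
      unfolding EY by (simp add: diff_divide_distrib)
    also have "\<bar>\<dots>\<bar> \<le> (112 * (B + 1)\<^sup>2 * (L n)\<^sup>2 / real n) / real n"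
      unfolding abs_divide abs_of_nat by (rule divide_right_mono[OF dr]) simp
    also have "\<dots> \<le> \<eta> n / real n"
    proof -
      have "(L n)\<^sup>2 \<le> L n ^ 3" using props(2) by (intro power_increasing) auto
      then have "112 * (B + 1)\<^sup>2 * (L n)\<^sup>2 \<le> 784 * (B + 1)\<^sup>2 * L n ^ 3"
        using props(2) by (intro mult_mono) auto
      then show ?thesis unfolding \<eta>_def by (auto intro!: divide_right_mono)
    qed
    finally show "\<bar>?E (\<lambda>H. Y j n H - Y j n G) - 2 / real n * bf_rhs j (\<lambda>i. Y i n G)\<bar> \<le> \<eta> n / real n" .
    have "?E (\<lambda>H. (Y j n H - Y j n G)\<^sup>2)
        = ?E (\<lambda>H. (comp_sum (bf_stat j) n H - comp_sum (bf_stat j) n G)\<^sup>2) / (real n)\<^sup>2"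
      unfolding Y_def diff_divide_distrib[symmetric] power_divide by simp
    also have "\<dots> \<le> 784 * (B + 1)\<^sup>2 * L n ^ 3 / (real n)\<^sup>2"
      by (intro divide_right_mono bf_step_jump[OF n props(1) growth B1 props(2,3,4)]) auto
    finally show "?E (\<lambda>H. (Y j n H - Y j n G)\<^sup>2) \<le> \<eta> n / real n"
      by (simp add: \<eta>_def power2_eq_square)
  qed (use t B ode \<eta> that in \<open>auto simp: finite_set_bf_step J_def K_def \<eta>_def L_def\<close>)
  \<comment> \<open>The exponent 1 is excluded because index 1 has been reused for the isolated
    vertices.\<close>
  have "susc k n G = Y k n G" if "k \<noteq> 1" for k n G
    using that by (simp add: susc_def Y_def comp_sum_def bf_stat_def)
  then have "susc 2 = Y 2" "susc 3 = Y 3" "susc 4 = Y 4" by (auto simp: fun_eq_iff)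
  moreover have "BF t = (\<lambda>n. bf n (nat \<lfloor>real n * t / 2\<rfloor>))" by (simp add: fun_eq_iff BF_def)
  ultimately show ?thesis using conv[of 2] conv[of 3] conv[of 4] by (simp add: J_def y_def)
qed

end
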